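(* Let $H$ be a finite simple graph with $|V(H)|=n$, let $m=\operatorname{girth}(H)$, let $G=W(H)$ be the whisker graph of $H$, and let $\mathbb{K}$ be a field. (1) The complex $\mathsf{MF}^{2}(G)$ is Cohen-Macaulay over $\mathbb{K}$ if and only if $H$ does not contain an induced cycle of length $3$. (2) If $n\ge 2$, then $m=\infty$ if and only if $\mathsf{MF}^{\,n-1}(G)$ is Cohen-Macaulay over $\mathbb{K}$.
   Context: For a finite simple graph $H$ with vertices $x_1,\dots,x_n$, the whisker graph $W(H)$ has vertex set $\{x_1,\dots,x_n,y_1,\dots,y_n\}$ (the $y_i$ being new vertices) and edge set $E(H)\cup\{\{x_i,y_i\}: 1\le i\le n\}$. The girth of $H$ is the length of its shortest cycle, with $\operatorname{girth}(H)=\infty$ if $H$ is acyclic. For an integer $q\ge1$, $\mathsf{MF}^q(G)$ is the simplicial complex on $V(G)$ whose faces are the subsets $F\subseteq V(G)$ such that the induced subgraph $G[F]$ contains no matching (set of pairwise disjoint edges) of size $q$. A simplicial complex $\Delta$ is Cohen-Macaulay over $\mathbb{K}$ if $\widetilde H_i(\operatorname{link}_\Delta(\sigma);\mathbb{K})=0$ for all $\sigma\in\Delta$ and all $i<\dim\operatorname{link}_\Delta(\sigma)$; equivalently, its Stanley-Reisner ring over $\mathbb{K}$ is Cohen-Macaulay. *)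

theory Defs
  imports Main "HOL-Library.Extended_Nat"
begin

type_synonym 'a graph = "'a set \<times> 'a set set"

abbreviation verts :: "'a graph \<Rightarrow> 'a set" where "verts \<equiv> fst"
abbreviation edges :: "'a graph \<Rightarrow> 'a set set" where "edges \<equiv> snd"

definition finite_simple_graph :: "'a graph \<Rightarrow> bool" where
  "finite_simple_graph G \<longleftrightarrow>
     finite (verts G) \<and> (\<forall>e\<in>edges G. e \<subseteq> verts G \<and> card e = 2)"

definition induced_subgraph :: "'a graph \<Rightarrow> 'a set \<Rightarrow> 'a graph" where
  "induced_subgraph G F = (F, {e \<in> edges G. e \<subseteq> F})"

(* The vertex x of H becomes Inl x; its new whisker vertex is Inr x. *)
definition whisker :: "'a graph \<Rightarrow> ('a + 'a) graph" where
  "whisker H = (verts H <+> verts H,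
     (\<lambda>e. Inl ` e) ` edges H \<union> (\<lambda>x. {Inl x, Inr x}) ` verts H)"

definition cycle_edges :: "'a list \<Rightarrow> 'a set set" where
  "cycle_edges c = {{c ! i, c ! (Suc i mod length c)} | i. i < length c}"

definition is_cycle :: "'a graph \<Rightarrow> 'a list \<Rightarrow> bool" where
  "is_cycle G c \<longleftrightarrow> 3 \<le> length c \<and> distinct c \<and> set c \<subseteq> verts G \<and> cycle_edges c \<subseteq> edges G"

definition is_induced_cycle :: "'a graph \<Rightarrow> 'a list \<Rightarrow> bool" where
  "is_induced_cycle G c \<longleftrightarrow>
     is_cycle G c \<and> edges (induced_subgraph G (set c)) = cycle_edges c"

(* The infimum over the empty set in enat is \<infinity>. *)
definition girth :: "'a graph \<Rightarrow> enat" where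
  "girth G = (INF c\<in>{c. is_cycle G c}. enat (length c))"

definition is_matching :: "'a graph \<Rightarrow> 'a set set \<Rightarrow> bool" where
  "is_matching G M \<longleftrightarrow> M \<subseteq> edges G \<and> pairwise disjnt M"

definition matching_free_complex :: "nat \<Rightarrow> 'a graph \<Rightarrow> 'a set set" where
  "matching_free_complex q G =
     {F. F \<subseteq> verts G \<and> \<not> (\<exists>M. is_matching (induced_subgraph G F) M \<and> card M = q)}"

(* Simplicial complexes are finite, nonempty families of finite sets that are closed under
   subsets; in particular they contain the empty face, of dimension -1. *)

definition link :: "'a set set \<Rightarrow> 'a set \<Rightarrow> 'a set set" where
  "link \<Delta> \<sigma> = {\<tau>. \<tau> \<inter> \<sigma> = {} \<and> \<tau> \<union> \<sigma> \<in> \<Delta>}"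

definition dimension :: "'a set set \<Rightarrow> int" where
  "dimension \<Delta> = int (Max (card ` \<Delta>)) - 1"

(* The oriented simplicial chain group in degree i, including the augmentation degree -1.
   The list [v0, ..., vi] stands for the oriented simplex it spans, and a chain assigns to each
   oriented i-simplex its coefficient, which changes sign with the orientation.  Adjacent
   transpositions generate all permutations, so it is enough to require the sign rule for them. *)
definition oriented_chains :: "'a set set \<Rightarrow> int \<Rightarrow> ('a list \<Rightarrow> 'k::field) set" where
  "oriented_chains \<Delta> i = {c.
     (\<forall>xs. c xs \<noteq> 0 \<longrightarrow> distinct xs \<and> set xs \<in> \<Delta> \<and> int (length xs) = i + 1) \<and>
     (\<forall>xs x y ys. c (xs @ x # y # ys) = - c (xs @ y # x # ys))}"

(* This is the linear extension of
     d [v0, ..., vi] = (sum j = 0..i. (-1)^j [v0, ..., omit vj, ..., vi]),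
   read off coefficientwise: an oriented simplex that has [xs] as a codimension one face can be
   written as [v, xs] for a unique vertex v, and then [xs] occurs in its boundary with
   coefficient +1.  In degree 0 this is the augmentation map. *)
definition boundary :: "'a set set \<Rightarrow> ('a list \<Rightarrow> 'k::field) \<Rightarrow> 'a list \<Rightarrow> 'k" where
  "boundary \<Delta> c = (\<lambda>xs. \<Sum>v\<in>\<Union>\<Delta>. c (v # xs))"

definition cycles :: "'a set set \<Rightarrow> int \<Rightarrow> ('a list \<Rightarrow> 'k::field) set" where
  "cycles \<Delta> i = {z \<in> oriented_chains \<Delta> i. boundary \<Delta> z = (\<lambda>_. 0)}"

definition boundaries :: "'a set set \<Rightarrow> int \<Rightarrow> ('a list \<Rightarrow> 'k::field) set" where
  "boundaries \<Delta> i = boundary \<Delta> ` oriented_chains \<Delta> (i + 1)"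

definition reduced_homology_vanishes :: "'k::field itself \<Rightarrow> 'a set set \<Rightarrow> int \<Rightarrow> bool" where
  "reduced_homology_vanishes K \<Delta> i \<longleftrightarrow>
     (cycles \<Delta> i :: ('a list \<Rightarrow> 'k) set) = boundaries \<Delta> i"

definition cohen_macaulay :: "'k::field itself \<Rightarrow> 'a set set \<Rightarrow> bool" where
  "cohen_macaulay K \<Delta> \<longleftrightarrow>
     (\<forall>\<sigma>\<in>\<Delta>. \<forall>i < dimension (link \<Delta> \<sigma>). reduced_homology_vanishes K (link \<Delta> \<sigma>) i)"

end

theory Submission
  imports Defs
begin

text \<open>Cohen-Macaulayness is assembled from simplices by gluing. If two subcomplexes have the vanishing
required in dimension \<open>d\<close> and their intersection has it in dimension \<open>d - 1\<close>, then so does the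
union, by the Mayer-Vietoris argument applied to every link (\<open>cm_of_dim_Un\<close>). Two ways of
building complexes follow: adding a cone over a link (\<open>cm_of_dim_cone\<close>) and adding facets along
a shelling (\<open>cm_of_dim_shelling\<close>).

For \<open>q = 2\<close>, let \<open>H\<close> be triangle-free. In a triangle-free graph, edges that pairwise meet share
a vertex, so a face of the complex is a set all of whose edges run through one vertex \<open>x\<close> of
\<open>H\<close>. Hence its facets are the sets consisting of \<open>x\<close>, an independent set \<open>A\<close> avoiding \<open>x\<close>, and
the whisker vertices over all base vertices outside \<open>A\<close>. Ordered by the size of \<open>A\<close>, with ties
broken by \<open>x\<close>, they form a shelling (\<open>star_facets_shelling\<close>). If \<open>H\<close> has a triangle \<open>x, y, z\<close>,
then the link of the face formed by \<open>x\<close>, \<open>y\<close> and the whisker vertices over the complement of the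
triangle has \<open>z\<close> as an isolated vertex, but it also has an edge, which gives nonzero homology in
degree \<open>0\<close>.

For \<open>q = n - 1\<close>, a matching of that size in \<open>W(H)\<close> misses exactly two vertices, and the missed
pairs are the edges of a second whisker graph of \<open>H\<close>, in which the roles of the vertices \<open>x\<^sub>i\<close>
and \<open>y\<^sub>i\<close> are exchanged. So the complex is the Alexander dual of that graph, regarded as a
complex of dimension at most \<open>1\<close> (\<open>matching_free_corank_1_eq_graph_dual\<close>). For a forest,
removing a vertex of degree at most one splits the dual into a cone over the dual of a smaller
forest and a simple piece (\<open>cm_graph_dual_forest\<close>). A cycle of the graph, on the other hand, is
dual to a nonzero homology class just below the top dimension (\<open>graph_dual_cycle_homology\<close>).\<close>

section \<open>Chains and homology of finite simplicial complexes\<close>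

text \<open>The vertex set \<open>V\<close> may be larger than the set of vertices that occur in faces, and \<open>\<Delta>\<close> may be
void (without even the empty face). Both relaxations allow subcomplexes and links, including
those at sets that are not faces, to be treated over one common \<open>V\<close>.\<close>

definition simplicial :: "'a set \<Rightarrow> 'a set set \<Rightarrow> bool" where
  "simplicial V \<Delta> \<longleftrightarrow> finite V \<and> \<Delta> \<subseteq> Pow V \<and> (\<forall>F\<in>\<Delta>. \<forall>E. E \<subseteq> F \<longrightarrow> E \<in> \<Delta>)"

lemma simplicialI:
  assumes "finite V" "\<And>F. F \<in> \<Delta> \<Longrightarrow> F \<subseteq> V" "\<And>E F. F \<in> \<Delta> \<Longrightarrow> E \<subseteq> F \<Longrightarrow> E \<in> \<Delta>"
  shows "simplicial V \<Delta>"
  using assms by (auto simp: simplicial_def)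

lemma simplicialD:
  assumes "simplicial V \<Delta>"
  shows "finite V" "F \<in> \<Delta> \<Longrightarrow> F \<subseteq> V" "F \<in> \<Delta> \<Longrightarrow> E \<subseteq> F \<Longrightarrow> E \<in> \<Delta>" "F \<in> \<Delta> \<Longrightarrow> finite F"
  using assms finite_subset[of F V] unfolding simplicial_def by blast+

lemma simplicial_mono_verts: "simplicial V \<Delta> \<Longrightarrow> V \<subseteq> W \<Longrightarrow> finite W \<Longrightarrow> simplicial W \<Delta>"
  by (auto simp: simplicial_def)

lemma simplicial_Un: "simplicial V A \<Longrightarrow> simplicial V B \<Longrightarrow> simplicial V (A \<union> B)"
  by (auto simp: simplicial_def)

lemma simplicial_Int: "simplicial V A \<Longrightarrow> simplicial V B \<Longrightarrow> simplicial V (A \<inter> B)"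
  by (auto simp: simplicial_def)

lemma simplicial_link:
  assumes "simplicial V \<Delta>" shows "simplicial V (link \<Delta> \<sigma>)"
proof (rule simplicialI)
  show "finite V" using assms by (rule simplicialD)
  show "F \<subseteq> V" if "F \<in> link \<Delta> \<sigma>" for F
    using that simplicialD(2)[OF assms] by (auto simp: link_def)
  show "E \<in> link \<Delta> \<sigma>" if "F \<in> link \<Delta> \<sigma>" "E \<subseteq> F" for E F
    using that simplicialD(3)[OF assms, of "F \<union> \<sigma>" "E \<union> \<sigma>"] by (auto simp: link_def)
qed

lemma link_Un: "link (A \<union> B) \<sigma> = link A \<sigma> \<union> link B \<sigma>"
  by (auto simp: link_def)

lemma link_Int: "link (A \<inter> B) \<sigma> = link A \<sigma> \<inter> link B \<sigma>"
  by (auto simp: link_def)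

lemma link_empty_face [simp]: "link \<Delta> {} = \<Delta>"
  by (auto simp: link_def)

lemma link_nonface:
  assumes "simplicial V \<Delta>" "\<sigma> \<notin> \<Delta>" shows "link \<Delta> \<sigma> = {}"
  using assms simplicialD(3)[OF assms(1), of _ \<sigma>] by (auto simp: link_def)

lemma empty_in_link: "\<sigma> \<in> \<Delta> \<Longrightarrow> {} \<in> link \<Delta> \<sigma>"
  by (auto simp: link_def)


lemma chainI:
  assumes "\<And>xs. c xs \<noteq> 0 \<Longrightarrow> distinct xs \<and> set xs \<in> \<Delta> \<and> int (length xs) = i + 1"
    and "\<And>xs x y ys. c (xs @ x # y # ys) = - c (xs @ y # x # ys)"
  shows "c \<in> oriented_chains \<Delta> i"
  unfolding oriented_chains_def
proof (rule CollectI, rule conjI)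
  show "\<forall>xs. c xs \<noteq> 0 \<longrightarrow> distinct xs \<and> set xs \<in> \<Delta> \<and> int (length xs) = i + 1"
    using assms(1) by blast
  show "\<forall>xs x y ys. c (xs @ x # y # ys) = - c (xs @ y # x # ys)"
    by (intro allI) (rule assms(2))
qed

lemma chainD:
  assumes "c \<in> oriented_chains \<Delta> i"
  shows "c xs \<noteq> 0 \<Longrightarrow> distinct xs" "c xs \<noteq> 0 \<Longrightarrow> set xs \<in> \<Delta>"
    "c xs \<noteq> 0 \<Longrightarrow> int (length xs) = i + 1"
  using CollectD[OF assms[unfolded oriented_chains_def], THEN conjunct1] by blast+

lemma chain_swap:
  assumes "c \<in> oriented_chains \<Delta> i"
  shows "c (xs @ x # y # ys) = - c (xs @ y # x # ys)"
  by (rule CollectD[OF assms[unfolded oriented_chains_def], THEN conjunct2, rule_format])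

lemma chain_add:
  assumes "c \<in> oriented_chains \<Delta> i" "d \<in> oriented_chains \<Delta> i"
  shows "(\<lambda>xs. c xs + d xs) \<in> oriented_chains \<Delta> i"
proof (rule chainI)
  fix xs assume "c xs + d xs \<noteq> 0"
  then have "c xs \<noteq> 0 \<or> d xs \<noteq> 0" by auto
  then show "distinct xs \<and> set xs \<in> \<Delta> \<and> int (length xs) = i + 1"
    using chainD[OF assms(1)] chainD[OF assms(2)] by blast
next
  fix xs x y ys
  show "c (xs @ x # y # ys) + d (xs @ x # y # ys) = - (c (xs @ y # x # ys) + d (xs @ y # x # ys))"
    using chain_swap[OF assms(1), of xs x y ys] chain_swap[OF assms(2), of xs x y ys] by simp
qed

lemma chain_diff:
  assumes "c \<in> oriented_chains \<Delta> i" "d \<in> oriented_chains \<Delta> i"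
  shows "(\<lambda>xs. c xs - d xs) \<in> oriented_chains \<Delta> i"
proof (rule chainI)
  fix xs assume "c xs - d xs \<noteq> 0"
  then have "c xs \<noteq> 0 \<or> d xs \<noteq> 0" by auto
  then show "distinct xs \<and> set xs \<in> \<Delta> \<and> int (length xs) = i + 1"
    using chainD[OF assms(1)] chainD[OF assms(2)] by blast
next
  fix xs x y ys
  show "c (xs @ x # y # ys) - d (xs @ x # y # ys) = - (c (xs @ y # x # ys) - d (xs @ y # x # ys))"
    using chain_swap[OF assms(1), of xs x y ys] chain_swap[OF assms(2), of xs x y ys] by simp
qed

lemma chain_mono:
  assumes "c \<in> oriented_chains A i" "A \<subseteq> B"
  shows "c \<in> oriented_chains B i"
proof (rule chainI)
  show "distinct xs \<and> set xs \<in> B \<and> int (length xs) = i + 1" if "c xs \<noteq> 0" for xs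
    using chainD[OF assms(1) that] assms(2) by blast
qed (rule chain_swap[OF assms(1)])

lemma chain_restrict:
  fixes c :: "'a list \<Rightarrow> 'k::field"
  assumes c: "c \<in> oriented_chains \<Delta> i"
    and A: "\<And>xs. c xs \<noteq> 0 \<Longrightarrow> P (set xs) \<Longrightarrow> set xs \<in> A"
  shows "(\<lambda>xs. if P (set xs) then c xs else 0) \<in> oriented_chains A i"
proof (rule chainI)
  fix xs assume "(if P (set xs) then c xs else 0) \<noteq> 0"
  then have "c xs \<noteq> 0" "P (set xs)" by (simp_all split: if_splits)
  then show "distinct xs \<and> set xs \<in> A \<and> int (length xs) = i + 1"
    using chainD[OF c, of xs] A[of xs] by blast
next
  fix xs ys :: "'a list" and x y
  have P: "P (set (xs @ x # y # ys)) \<longleftrightarrow> P (set (xs @ y # x # ys))"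
    by (simp add: insert_commute)
  show "(if P (set (xs @ x # y # ys)) then c (xs @ x # y # ys) else 0) =
      - (if P (set (xs @ y # x # ys)) then c (xs @ y # x # ys) else 0)"
    unfolding P by (simp add: chain_swap[OF c, of xs x y ys])
qed

text \<open>Summing over a fixed ambient vertex set makes the boundary of a chain independent of the complex
in which it is taken, so that chains of different subcomplexes can be compared.\<close>

definition boundary_on :: "'a set \<Rightarrow> ('a list \<Rightarrow> 'k::field) \<Rightarrow> 'a list \<Rightarrow> 'k" where
  "boundary_on V c xs = (\<Sum>v\<in>V. c (v # xs))"

lemma boundary_eq_boundary_on:
  assumes "simplicial V \<Delta>" "c \<in> oriented_chains \<Delta> i"
  shows "boundary \<Delta> c = boundary_on V c"
proof
  fix xs
  have "\<Union>\<Delta> \<subseteq> V" using simplicialD(2)[OF assms(1)] by blast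
  moreover have "c (v # xs) = 0" if "v \<in> V - \<Union>\<Delta>" for v
    using chainD(2)[OF assms(2), of "v # xs"] that by auto
  ultimately show "boundary \<Delta> c xs = boundary_on V c xs"
    unfolding boundary_def boundary_on_def
    by (intro sum.mono_neutral_left) (use simplicialD(1)[OF assms(1)] in auto)
qed

lemma boundary_on_add: "boundary_on V (\<lambda>xs. c xs + d xs) = (\<lambda>xs. boundary_on V c xs + boundary_on V d xs)"
  by (auto simp: boundary_on_def sum.distrib)

lemma boundary_on_diff: "boundary_on V (\<lambda>xs. c xs - d xs) = (\<lambda>xs. boundary_on V c xs - boundary_on V d xs)"
  by (auto simp: boundary_on_def sum_subtractf)

lemma boundary_on_chain:
  assumes "simplicial V \<Delta>" "c \<in> oriented_chains \<Delta> i"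
  shows "boundary_on V c \<in> oriented_chains \<Delta> (i - 1)"
proof (rule chainI)
  fix xs assume "boundary_on V c xs \<noteq> 0"
  then obtain v where "v \<in> V" "c (v # xs) \<noteq> 0"
    unfolding boundary_on_def by (meson sum.neutral)
  from chainD[OF assms(2) this(2)] simplicialD(3)[OF assms(1), of "set (v # xs)" "set xs"]
  show "distinct xs \<and> set xs \<in> \<Delta> \<and> int (length xs) = i - 1 + 1" by auto
next
  fix xs x y ys
  have "c (v # xs @ x # y # ys) = - c (v # xs @ y # x # ys)" for v
    using chain_swap[OF assms(2), of "v # xs" x y ys] by simp
  then show "boundary_on V c (xs @ x # y # ys) = - boundary_on V c (xs @ y # x # ys)"
    by (simp add: boundary_on_def sum_negf)
qed

text \<open>The diagonal terms are required to vanish separately, which makes the statement true in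
characteristic \<open>2\<close> as well.\<close>

lemma sum_antisymmetric:
  fixes f :: "'a \<Rightarrow> 'a \<Rightarrow> 'k::ab_group_add"
  assumes "finite V" "\<And>v. f v v = 0" "\<And>v w. f v w = - f w v"
  shows "(\<Sum>v\<in>V. \<Sum>w\<in>V. f v w) = 0"
  using assms(1)
proof induction
  case (insert u V)
  have "(\<Sum>v\<in>V. f v u) = - (\<Sum>w\<in>V. f u w)"
    unfolding sum_negf[symmetric] using assms(3) by (rule sum.cong[OF refl])
  with insert show ?case by (simp add: sum.distrib assms(2))
qed simp

lemma boundary_on_boundary_on:
  assumes "simplicial V \<Delta>" "c \<in> oriented_chains \<Delta> i"
  shows "boundary_on V (boundary_on V c) = (\<lambda>_. 0)"
proof
  fix xs
  have "(\<Sum>v\<in>V. \<Sum>w\<in>V. c (w # v # xs)) = 0"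
  proof (rule sum_antisymmetric)
    show "finite V" using assms(1) by (rule simplicialD)
    show "c (v # v # xs) = 0" for v using chainD(1)[OF assms(2), of "v # v # xs"] by auto
    show "c (w # v # xs) = - c (v # w # xs)" for v w
      using chain_swap[OF assms(2), of "[]" w v xs] by simp
  qed
  then show "boundary_on V (boundary_on V c) xs = 0" by (simp add: boundary_on_def)
qed

text \<open>Boundaries are always cycles, so only the reverse inclusion carries information.\<close>

lemma vanishes_iff:
  fixes K :: "'k::field itself"
  assumes "simplicial V \<Delta>"
  shows "reduced_homology_vanishes K \<Delta> i \<longleftrightarrow>
    (\<forall>z::'a list \<Rightarrow> 'k. z \<in> oriented_chains \<Delta> i \<longrightarrow> boundary_on V z = (\<lambda>_. 0) \<longrightarrow>
       (\<exists>b\<in>oriented_chains \<Delta> (i + 1). boundary_on V b = z))"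
proof -
  define Z where "Z = {z :: 'a list \<Rightarrow> 'k. z \<in> oriented_chains \<Delta> i \<and> boundary_on V z = (\<lambda>_. 0)}"
  define B where "B = boundary_on V ` (oriented_chains \<Delta> (i + 1) :: ('a list \<Rightarrow> 'k) set)"
  have "boundaries \<Delta> i = B"
    unfolding boundaries_def B_def by (intro image_cong refl boundary_eq_boundary_on[OF assms])
  moreover have "cycles \<Delta> i = Z"
    unfolding cycles_def Z_def by (intro Collect_cong conj_cong refl) (simp add: boundary_eq_boundary_on[OF assms])
  moreover have "B \<subseteq> Z"
    using boundary_on_chain[OF assms, of _ "i + 1"] boundary_on_boundary_on[OF assms] by (auto simp: B_def Z_def)
  ultimately have "reduced_homology_vanishes K \<Delta> i \<longleftrightarrow> (\<forall>z\<in>Z. z \<in> B)"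
    unfolding reduced_homology_vanishes_def by auto
  also have "\<dots> \<longleftrightarrow> (\<forall>z::'a list \<Rightarrow> 'k. z \<in> oriented_chains \<Delta> i \<longrightarrow> boundary_on V z = (\<lambda>_. 0) \<longrightarrow>
       (\<exists>b\<in>oriented_chains \<Delta> (i + 1). boundary_on V b = z))"
    unfolding Z_def B_def image_iff eq_commute[of _ "boundary_on V _"] by blast
  finally show ?thesis .
qed

text \<open>This is the exactness of the Mayer-Vietoris sequence at the homology of the union: a cycle is
split into a part in \<open>A\<close> and a part in \<open>B\<close>, whose boundaries cancel and therefore form a cycle
in \<open>A \<inter> B\<close>; a filling of the latter corrects both parts to cycles.\<close>

lemma vanishes_Un:
  fixes K :: "'k::field itself"
  assumes A: "simplicial V A" and B: "simplicial V B"
    and HA: "reduced_homology_vanishes K A i" and HB: "reduced_homology_vanishes K B i"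
    and HAB: "reduced_homology_vanishes K (A \<inter> B) (i - 1)"
  shows "reduced_homology_vanishes K (A \<union> B) i"
  unfolding vanishes_iff[OF simplicial_Un[OF A B]]
proof (intro allI impI)
  fix z :: "'a list \<Rightarrow> 'k"
  assume z: "z \<in> oriented_chains (A \<union> B) i" and z0: "boundary_on V z = (\<lambda>_. 0)"
  define a where "a = (\<lambda>xs. if set xs \<in> A then z xs else 0)"
  define b where "b = (\<lambda>xs. if set xs \<notin> A then z xs else 0)"
  have a: "a \<in> oriented_chains A i"
    unfolding a_def by (rule chain_restrict[OF z])
  have b: "b \<in> oriented_chains B i"
    unfolding b_def by (rule chain_restrict[OF z]) (use chainD(2)[OF z] in auto)
  have zab: "z = (\<lambda>xs. a xs + b xs)" by (auto simp: a_def b_def)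
  have ab: "boundary_on V a xs = - boundary_on V b xs" for xs
    using fun_cong[OF z0, of xs] by (simp add: zab boundary_on_add eq_neg_iff_add_eq_0)
  have "boundary_on V a \<in> oriented_chains (A \<inter> B) (i - 1)"
  proof (rule chainI)
    fix xs assume "boundary_on V a xs \<noteq> 0"
    then show "distinct xs \<and> set xs \<in> A \<inter> B \<and> int (length xs) = i - 1 + 1"
      using chainD[OF boundary_on_chain[OF A a], of xs] chainD[OF boundary_on_chain[OF B b], of xs] ab by auto
  qed (rule chain_swap[OF boundary_on_chain[OF A a]])
  then obtain c where c: "c \<in> oriented_chains (A \<inter> B) i" "boundary_on V c = boundary_on V a"
    using HAB boundary_on_boundary_on[OF A a] unfolding vanishes_iff[OF simplicial_Int[OF A B]] by force
  have "(\<lambda>xs. a xs - c xs) \<in> oriented_chains A i"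
    using a c by (intro chain_diff) (auto intro: chain_mono)
  moreover have "boundary_on V (\<lambda>xs. a xs - c xs) = (\<lambda>_. 0)" by (simp add: boundary_on_diff c)
  ultimately obtain a' where a': "a' \<in> oriented_chains A (i + 1)" "boundary_on V a' = (\<lambda>xs. a xs - c xs)"
    using HA unfolding vanishes_iff[OF A] by blast
  have "(\<lambda>xs. b xs + c xs) \<in> oriented_chains B i"
    using b c by (intro chain_add) (auto intro: chain_mono)
  moreover have "boundary_on V (\<lambda>xs. b xs + c xs) = (\<lambda>_. 0)" by (simp add: boundary_on_add c ab)
  ultimately obtain b' where b': "b' \<in> oriented_chains B (i + 1)" "boundary_on V b' = (\<lambda>xs. b xs + c xs)"
    using HB unfolding vanishes_iff[OF B] by blast
  show "\<exists>b\<in>oriented_chains (A \<union> B) (i + 1). boundary_on V b = z"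
  proof
    show "(\<lambda>xs. a' xs + b' xs) \<in> oriented_chains (A \<union> B) (i + 1)"
      using a' b' by (intro chain_add) (auto intro: chain_mono)
    show "boundary_on V (\<lambda>xs. a' xs + b' xs) = z" by (simp add: boundary_on_add a' b' zab)
  qed
qed

lemma chain_move_to_front:
  assumes "c \<in> oriented_chains \<Delta> i"
  shows "c (ps @ x # qs) = (-1) ^ length ps * c (x # ps @ qs)"
proof (induction ps arbitrary: qs rule: rev_induct)
  case (snoc p ps)
  have "c ((ps @ [p]) @ x # qs) = - c (ps @ x # p # qs)"
    using chain_swap[OF assms, of ps p x qs] by simp
  also have "\<dots> = - ((-1) ^ length ps * c (x # ps @ p # qs))" by (simp add: snoc)
  finally show ?case by simp
qed simp

text \<open>The join \<open>v * c\<close>. The coefficient at a list starting with \<open>v\<close> is that of \<open>c\<close> at the remaining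
list; the sign accounts for moving \<open>v\<close> to the front.\<close>

definition cone_chain :: "'a \<Rightarrow> ('a list \<Rightarrow> 'k::field) \<Rightarrow> 'a list \<Rightarrow> 'k" where
  "cone_chain v c xs = (if distinct xs \<and> v \<in> set xs
     then (-1) ^ length (takeWhile (\<lambda>x. x \<noteq> v) xs) * c (remove1 v xs) else 0)"

lemma cone_chain_split:
  assumes "distinct (ps @ v # qs)"
  shows "cone_chain v c (ps @ v # qs) = (-1) ^ length ps * c (ps @ qs)"
proof -
  have "takeWhile (\<lambda>x. x \<noteq> v) (ps @ v # qs) = ps"
    using assms by (subst takeWhile_append2) auto
  moreover have "remove1 v (ps @ v # qs) = ps @ qs" using assms by (simp add: remove1_append)
  ultimately show ?thesis using assms by (simp add: cone_chain_def)
qed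

lemma cone_chain_swap:
  assumes c: "c \<in> oriented_chains \<Delta> i"
  shows "cone_chain v c (xs @ x # y # ys) = - cone_chain v c (xs @ y # x # ys)"
proof (cases "distinct (xs @ x # y # ys) \<and> v \<in> set (xs @ x # y # ys)")
  case False
  then show ?thesis by (auto simp: cone_chain_def)
next
  case True
  then have d: "distinct (xs @ x # y # ys)" "distinct (xs @ y # x # ys)" by auto
  consider "v \<in> set xs" | "v = x" | "v = y" | "v \<in> set ys" using True by auto
  then show ?thesis
  proof cases
    case 1
    then obtain ps qs where xs: "xs = ps @ v # qs" by (meson split_list)
    show ?thesis
      using d cone_chain_split[of ps v "qs @ x # y # ys" c] cone_chain_split[of ps v "qs @ y # x # ys" c]
        chain_swap[OF c, of "ps @ qs" x y ys] by (simp add: xs)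
  next
    case 2
    then show ?thesis
      using d cone_chain_split[of xs v "y # ys" c] cone_chain_split[of "xs @ [y]" v ys c] by simp
  next
    case 3
    then show ?thesis
      using d cone_chain_split[of xs v "x # ys" c] cone_chain_split[of "xs @ [x]" v ys c] by simp
  next
    case 4
    then obtain ps qs where ys: "ys = ps @ v # qs" by (meson split_list)
    show ?thesis
      using d cone_chain_split[of "xs @ x # y # ps" v qs c] cone_chain_split[of "xs @ y # x # ps" v qs c]
        chain_swap[OF c, of xs x y "ps @ qs"] by (simp add: ys)
  qed
qed

text \<open>Joining with the apex is a contracting homotopy: every cycle \<open>z\<close> is the boundary of \<open>v * z\<close>.\<close>

lemma vanishes_cone:
  fixes K :: "'k::field itself"
  assumes \<Delta>: "simplicial V \<Delta>" and v: "v \<in> V" and cone: "\<And>F. F \<in> \<Delta> \<Longrightarrow> insert v F \<in> \<Delta>"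
  shows "reduced_homology_vanishes K \<Delta> i"
  unfolding vanishes_iff[OF \<Delta>]
proof (intro allI impI)
  fix z :: "'a list \<Rightarrow> 'k"
  assume z: "z \<in> oriented_chains \<Delta> i" and z0: "boundary_on V z = (\<lambda>_. 0)"
  show "\<exists>b\<in>oriented_chains \<Delta> (i + 1). boundary_on V b = z"
  proof
    show "cone_chain v z \<in> oriented_chains \<Delta> (i + 1)"
    proof (rule chainI)
      fix xs assume nz: "cone_chain v z xs \<noteq> 0"
      then have xs: "distinct xs" "v \<in> set xs" "z (remove1 v xs) \<noteq> 0"
        by (auto simp: cone_chain_def split: if_splits)
      have "insert v (set (remove1 v xs)) = set xs" using xs by auto
      moreover have "length xs = Suc (length (remove1 v xs))"
        using xs(2) length_pos_if_in_set[OF xs(2)] by (simp add: length_remove1)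
      ultimately show "distinct xs \<and> set xs \<in> \<Delta> \<and> int (length xs) = i + 1 + 1"
        using chainD[OF z xs(3)] cone[of "set (remove1 v xs)"] xs(1) by simp
    qed (rule cone_chain_swap[OF z])
    have fin: "finite V" using \<Delta> by (rule simplicialD)
    show "boundary_on V (cone_chain v z) = z"
    proof
      fix xs
      consider "\<not> distinct xs" | "distinct xs" "v \<notin> set xs" | "distinct xs" "v \<in> set xs" by auto
      then show "boundary_on V (cone_chain v z) xs = z xs"
      proof cases
        case 1
        then show ?thesis using chainD(1)[OF z, of xs] by (auto simp: boundary_on_def cone_chain_def)
      next
        case 2
        have "boundary_on V (cone_chain v z) xs = (\<Sum>w\<in>{v}. cone_chain v z (w # xs))"
          unfolding boundary_on_def
          by (rule sum.mono_neutral_right) (use 2 fin v in \<open>auto simp: cone_chain_def\<close>)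
        then show ?thesis using 2 by (simp add: cone_chain_def)
      next
        case 3
        then obtain ps qs where xs: "xs = ps @ v # qs" by (meson split_list)
        have t: "cone_chain v z (w # xs) = - ((-1) ^ length ps * z (w # ps @ qs))" if "w \<noteq> v" for w
        proof (cases "w \<in> set xs")
          case True
          have "z (w # ps @ qs) = 0" using chainD(1)[OF z, of "w # ps @ qs"] True that by (auto simp: xs)
          then show ?thesis using True by (auto simp: cone_chain_def)
        next
          case False
          then show ?thesis using cone_chain_split[of "w # ps" v qs z] 3 by (simp add: xs)
        qed
        have "boundary_on V (cone_chain v z) xs = (\<Sum>w\<in>V - {v}. cone_chain v z (w # xs)) + cone_chain v z (v # xs)"
          unfolding boundary_on_def by (simp add: sum.remove[OF fin v] add.commute)
        also have "cone_chain v z (v # xs) = 0" using 3 by (simp add: cone_chain_def)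
        also have "(\<Sum>w\<in>V - {v}. cone_chain v z (w # xs)) =
            - ((-1) ^ length ps * (\<Sum>w\<in>V - {v}. z (w # ps @ qs)))"
          by (simp add: t sum_negf sum_distrib_left)
        also have "(\<Sum>w\<in>V - {v}. z (w # ps @ qs)) = boundary_on V z (ps @ qs) - z (v # ps @ qs)"
          unfolding boundary_on_def by (simp add: sum.remove[OF fin v])
        finally show ?thesis
          using chain_move_to_front[OF z, of ps v qs] by (simp add: z0 xs)
      qed
    qed
  qed
qed

text \<open>The difference of the two vertices is a cycle, but the boundary of a \<open>1\<close>-chain has coefficient
\<open>0\<close> at the isolated vertex, because no edge contains it.\<close>

lemma isolated_vertex_homology:
  fixes K :: "'k::field itself"
  assumes \<Delta>: "simplicial V \<Delta>" and pq: "{p} \<in> \<Delta>" "{q} \<in> \<Delta>" "p \<noteq> q"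
    and isolated: "\<And>v. v \<noteq> p \<Longrightarrow> {v, p} \<notin> \<Delta>"
  shows "\<not> reduced_homology_vanishes K \<Delta> 0"
proof
  assume van: "reduced_homology_vanishes K \<Delta> 0"
  define z :: "'a list \<Rightarrow> 'k" where "z xs = (if xs = [p] then 1 else if xs = [q] then -1 else 0)" for xs
  have "z \<in> oriented_chains \<Delta> 0"
    by (rule chainI) (use pq in \<open>auto simp: z_def split: if_splits\<close>)
  moreover have "boundary_on V z = (\<lambda>_. 0)"
  proof
    fix xs
    have "boundary_on V z xs = (\<Sum>v\<in>{p, q}. z (v # xs))"
      unfolding boundary_on_def
    proof (rule sum.mono_neutral_right)
      show "finite V" by (rule simplicialD(1)[OF \<Delta>])
      show "{p, q} \<subseteq> V" using pq simplicialD(2)[OF \<Delta>] by blast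
    qed (simp add: z_def)
    then show "boundary_on V z xs = 0" using pq by (auto simp: z_def)
  qed
  ultimately obtain b where b: "b \<in> oriented_chains \<Delta> 1" "boundary_on V b = z"
    using van unfolding vanishes_iff[OF \<Delta>] by force
  have "b [v, p] = 0" for v
  proof (rule ccontr)
    assume nz: "b [v, p] \<noteq> 0"
    have "v \<noteq> p" "{v, p} \<in> \<Delta>" using chainD(1,2)[OF b(1) nz] by auto
    then show False using isolated by blast
  qed
  then have "boundary_on V b [p] = 0" by (simp add: boundary_on_def)
  then show False unfolding b(2) by (simp add: z_def)
qed

section \<open>Gluing Cohen-Macaulay complexes\<close>

text \<open>The Cohen-Macaulay condition with the dimensions of the links prescribed by a number \<open>d\<close>. Unlike
\<^const>\<open>cohen_macaulay\<close> it makes sense for void complexes and does not require the dimensions of links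
to be computed, which suits inductive constructions.\<close>

definition cm_of_dim :: "'k::field itself \<Rightarrow> int \<Rightarrow> 'a set set \<Rightarrow> bool" where
  "cm_of_dim K d \<Delta> \<longleftrightarrow>
     (\<forall>\<sigma>\<in>\<Delta>. \<forall>i < d - int (card \<sigma>). reduced_homology_vanishes K (link \<Delta> \<sigma>) i)"

lemma cm_of_dim_void [simp]: "cm_of_dim K d {}"
  by (simp add: cm_of_dim_def)

lemma cohen_macaulayI:
  assumes \<Delta>: "simplicial V \<Delta>" and cm: "cm_of_dim K d \<Delta>"
    and bound: "\<And>F. F \<in> \<Delta> \<Longrightarrow> int (card F) \<le> d + 1"
  shows "cohen_macaulay K \<Delta>"
  unfolding cohen_macaulay_def
proof (intro ballI allI impI)
  fix \<sigma> i assume \<sigma>: "\<sigma> \<in> \<Delta>" and i: "i < dimension (link \<Delta> \<sigma>)"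
  have fin: "finite (link \<Delta> \<sigma>)"
    using simplicial_link[OF \<Delta>, of \<sigma>] by (auto simp: simplicial_def intro: finite_subset)
  moreover have "link \<Delta> \<sigma> \<noteq> {}" using empty_in_link[OF \<sigma>] by auto
  ultimately obtain \<tau> where \<tau>: "\<tau> \<in> link \<Delta> \<sigma>" "Max (card ` link \<Delta> \<sigma>) = card \<tau>"
    by (metis (no_types, lifting) Max_in empty_is_image finite_imageI imageE)
  have "card (\<tau> \<union> \<sigma>) = card \<tau> + card \<sigma>"
    using \<tau>(1) \<sigma> simplicialD(4)[OF \<Delta>] simplicialD(4)[OF simplicial_link[OF \<Delta>]]
    by (intro card_Un_disjoint) (auto simp: link_def)
  then have "dimension (link \<Delta> \<sigma>) \<le> d - int (card \<sigma>)"
    using bound[of "\<tau> \<union> \<sigma>"] \<tau> by (auto simp: dimension_def link_def)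
  then show "reduced_homology_vanishes K (link \<Delta> \<sigma>) i"
    using cm \<sigma> i by (auto simp: cm_of_dim_def)
qed

lemma cohen_macaulayD:
  assumes cm: "cohen_macaulay K \<Delta>" and \<Delta>: "simplicial V \<Delta>" and \<sigma>: "\<sigma> \<in> \<Delta>"
    and F: "F \<in> link \<Delta> \<sigma>" and i: "i < int (card F) - 1"
  shows "reduced_homology_vanishes K (link \<Delta> \<sigma>) i"
proof -
  have "finite (link \<Delta> \<sigma>)"
    using simplicial_link[OF \<Delta>, of \<sigma>] unfolding simplicial_def by (metis finite_Pow_iff finite_subset)
  then have "card F \<le> Max (card ` link \<Delta> \<sigma>)" using F by (intro Max_ge) simp_all
  then have "i < dimension (link \<Delta> \<sigma>)" using i unfolding dimension_def by linarith
  then show ?thesis using cm \<sigma> unfolding cohen_macaulay_def by blast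
qed

text \<open>Links commute with unions and intersections, so this is Mayer-Vietoris in each link. A face of
only one of the two complexes has its whole link there, the link in the other one being void.\<close>

lemma cm_of_dim_Un:
  assumes A: "simplicial V A" and B: "simplicial V B"
    and "cm_of_dim K d A" "cm_of_dim K d B" "cm_of_dim K (d - 1) (A \<inter> B)"
  shows "cm_of_dim K d (A \<union> B)"
  unfolding cm_of_dim_def
proof (intro ballI allI impI)
  fix \<sigma> i assume \<sigma>: "\<sigma> \<in> A \<union> B" and i: "i < d - int (card \<sigma>)"
  consider "\<sigma> \<in> A" "\<sigma> \<in> B" | "\<sigma> \<in> A" "\<sigma> \<notin> B" | "\<sigma> \<notin> A" "\<sigma> \<in> B" using \<sigma> by auto
  then show "reduced_homology_vanishes K (link (A \<union> B) \<sigma>) i"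
  proof cases
    case 1
    have "reduced_homology_vanishes K (link A \<sigma> \<inter> link B \<sigma>) (i - 1)"
      using assms(5) 1 i unfolding cm_of_dim_def link_Int by auto
    then show ?thesis
      using 1 i assms(3,4) unfolding link_Un cm_of_dim_def
      by (intro vanishes_Un[of V]) (auto intro: simplicial_link A B)
  next
    case 2
    then show ?thesis using i assms(3) link_nonface[OF B] by (simp add: link_Un cm_of_dim_def)
  next
    case 3
    then show ?thesis using i assms(4) link_nonface[OF A] by (simp add: link_Un cm_of_dim_def)
  qed
qed

text \<open>The complex on the right is the cone over \<open>L\<close> with apex \<open>v\<close>. Links of faces without \<open>v\<close> are
cones again, hence acyclic, and links of faces through \<open>v\<close> are links in \<open>L\<close>.\<close>

lemma cm_of_dim_cone:
  fixes K :: "'k::field itself"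
  assumes L: "simplicial V L" and v: "\<And>F. F \<in> L \<Longrightarrow> v \<notin> F" and cm: "cm_of_dim K (d - 1) L"
  shows "cm_of_dim K d {F. F - {v} \<in> L}"
  unfolding cm_of_dim_def
proof (intro ballI allI impI)
  let ?C = "{F. F - {v} \<in> L}"
  fix \<sigma> i assume \<sigma>: "\<sigma> \<in> ?C" and i: "i < d - int (card \<sigma>)"
  have C: "simplicial (insert v V) ?C"
  proof (rule simplicialI)
    show "finite (insert v V)" using simplicialD(1)[OF L] by simp
    show "F \<subseteq> insert v V" if "F \<in> ?C" for F
      using that simplicialD(2)[OF L, of "F - {v}"] by auto
    show "E \<in> ?C" if "F \<in> ?C" "E \<subseteq> F" for E F
      using that simplicialD(3)[OF L, of "F - {v}" "E - {v}"] by auto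
  qed
  show "reduced_homology_vanishes K (link ?C \<sigma>) i"
  proof (cases "v \<in> \<sigma>")
    case True
    have eq: "\<tau> \<union> \<sigma> - {v} = \<tau> \<union> (\<sigma> - {v})" if "v \<notin> \<tau>" for \<tau> using that by blast
    have "link ?C \<sigma> = link L (\<sigma> - {v})"
    proof (intro set_eqI iffI)
      fix \<tau> assume "\<tau> \<in> link ?C \<sigma>"
      then have \<tau>: "\<tau> \<inter> \<sigma> = {}" "\<tau> \<union> \<sigma> - {v} \<in> L" by (simp_all add: link_def)
      then have "v \<notin> \<tau>" using True by blast
      then have "\<tau> \<union> (\<sigma> - {v}) \<in> L" using \<tau>(2) eq by metis
      then show "\<tau> \<in> link L (\<sigma> - {v})" using \<tau>(1) unfolding link_def by blast
    next
      fix \<tau> assume "\<tau> \<in> link L (\<sigma> - {v})"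
      then have \<tau>: "\<tau> \<inter> (\<sigma> - {v}) = {}" "\<tau> \<union> (\<sigma> - {v}) \<in> L" by (simp_all add: link_def)
      then have "v \<notin> \<tau>" using v by blast
      then have "\<tau> \<union> \<sigma> - {v} \<in> L" using \<tau>(2) eq by metis
      moreover have "\<tau> \<inter> \<sigma> = {}" using \<tau>(1) \<open>v \<notin> \<tau>\<close> by blast
      ultimately show "\<tau> \<in> link ?C \<sigma>" unfolding link_def by blast
    qed
    moreover have "finite \<sigma>" using simplicialD(4)[OF C \<sigma>] .
    then have "card (\<sigma> - {v}) + 1 = card \<sigma>" using True card.remove[of \<sigma> v] by simp
    then have "i < d - 1 - int (card (\<sigma> - {v}))" using i by simp
    moreover have "\<sigma> - {v} \<in> L" using \<sigma> by simp
    ultimately show ?thesis using cm unfolding cm_of_dim_def by metis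
  next
    case False
    show ?thesis
    proof (rule vanishes_cone[OF simplicial_link[OF C]])
      show "v \<in> insert v V" by simp
      show "insert v F \<in> link ?C \<sigma>" if "F \<in> link ?C \<sigma>" for F
        using that False by (simp add: link_def)
    qed
  qed
qed

lemma cm_of_dim_simplex:
  fixes K :: "'k::field itself"
  assumes "finite F"
  shows "cm_of_dim K (int (card F) - 1) (Pow F)"
  unfolding cm_of_dim_def
proof (intro ballI allI impI)
  fix \<sigma> i assume \<sigma>: "\<sigma> \<in> Pow F" and i: "i < int (card F) - 1 - int (card \<sigma>)"
  have F: "simplicial F (Pow F)" using assms by (auto intro: simplicialI)
  have "\<sigma> \<noteq> F \<or> i < -1" using i by auto
  then show "reduced_homology_vanishes K (link (Pow F) \<sigma>) i"
  proof
    assume "\<sigma> \<noteq> F"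
    then obtain v where "v \<in> F" "v \<notin> \<sigma>" using \<sigma> by auto
    then show ?thesis
      by (intro vanishes_cone[OF simplicial_link[OF F], of v]) (simp_all add: link_def)
  next
    assume "i < -1"
    have "z = (\<lambda>_. 0)" if "z \<in> oriented_chains (link (Pow F) \<sigma>) i" for z :: "'a list \<Rightarrow> 'k"
      using chainD(3)[OF that] \<open>i < -1\<close> by fastforce
    moreover have "(\<lambda>_. 0 :: 'k) \<in> oriented_chains (link (Pow F) \<sigma>) (i + 1)" by (auto intro: chainI)
    moreover have "boundary_on F (\<lambda>_. 0 :: 'k) = (\<lambda>_. 0)" by (auto simp: boundary_on_def)
    ultimately show ?thesis
      unfolding vanishes_iff[OF simplicial_link[OF F]] by metis
  qed
qed

lemma simplicial_not_above: "finite F \<Longrightarrow> simplicial F {X. X \<subseteq> F \<and> \<not> R \<subseteq> X}"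
  by (rule simplicialI) auto

text \<open>This complex is the boundary of the simplex \<open>R\<close> joined with the simplex \<open>F - R\<close>. Enlarging \<open>R\<close>
by a vertex \<open>w\<close> adds the facet \<open>F - {w}\<close>, which meets the previous complex in one of the same
kind. It is the shape in which a new facet of a shelling meets the earlier ones.\<close>

lemma cm_of_dim_not_above:
  fixes K :: "'k::field itself"
  assumes "finite F" "R \<subseteq> F"
  shows "cm_of_dim K (int (card F) - 2) {X. X \<subseteq> F \<and> \<not> R \<subseteq> X}"
proof -
  have "finite R" using assms finite_subset by blast
  then show ?thesis using assms
  proof (induction R arbitrary: F rule: finite_induct)
    case (insert w R)
    have w: "w \<in> F" "R \<subseteq> F - {w}" using insert by auto
    have card: "int (card (F - {w})) = int (card F) - 1"
      using card.remove[of F w] insert.prems w(1) by simp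
    have "cm_of_dim K (int (card F) - 2) ({X. X \<subseteq> F \<and> \<not> R \<subseteq> X} \<union> Pow (F - {w}))"
    proof (rule cm_of_dim_Un)
      show "simplicial F {X. X \<subseteq> F \<and> \<not> R \<subseteq> X}" by (rule simplicial_not_above) fact
      show "simplicial F (Pow (F - {w}))" using insert.prems by (intro simplicialI) auto
      show "cm_of_dim K (int (card F) - 2) {X. X \<subseteq> F \<and> \<not> R \<subseteq> X}" using insert by auto
      show "cm_of_dim K (int (card F) - 2) (Pow (F - {w}))"
        using cm_of_dim_simplex[of "F - {w}" K] insert.prems card by simp
      have "{X. X \<subseteq> F \<and> \<not> R \<subseteq> X} \<inter> Pow (F - {w}) = {X. X \<subseteq> F - {w} \<and> \<not> R \<subseteq> X}" by auto
      then show "cm_of_dim K (int (card F) - 2 - 1) ({X. X \<subseteq> F \<and> \<not> R \<subseteq> X} \<inter> Pow (F - {w}))"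
        using insert.IH[of "F - {w}"] insert.prems w card by simp
    qed
    moreover have "{X. X \<subseteq> F \<and> \<not> R \<subseteq> X} \<union> Pow (F - {w}) = {X. X \<subseteq> F \<and> \<not> insert w R \<subseteq> X}"
      by auto
    ultimately show ?case by simp
  qed simp
qed

text \<open>Shellable complexes are Cohen-Macaulay. Facets carry labels ordered by a natural number,
possibly with ties; the condition is the usual one for shellings, except that \<open>t\<close> ranges over
labels with the same key as well, so that any order among equal keys will do.\<close>

lemma cm_of_dim_shelling:
  fixes K :: "'k::field itself" and key :: "'s \<Rightarrow> nat" and facet :: "'s \<Rightarrow> 'a set"
  assumes "finite S" and "\<And>s. s \<in> S \<Longrightarrow> finite (facet s)"
    and "\<And>s. s \<in> S \<Longrightarrow> int (card (facet s)) = d + 1"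
    and "\<And>s t. s \<in> S \<Longrightarrow> t \<in> S \<Longrightarrow> t \<noteq> s \<Longrightarrow> key t \<le> key s \<Longrightarrow>
      \<exists>v\<in>facet s - facet t. \<exists>u\<in>S. key u < key s \<and> facet s - {v} \<subseteq> facet u"
  shows "cm_of_dim K d (\<Union>s\<in>S. Pow (facet s))"
  using assms
proof (induction "card S" arbitrary: S)
  case 0
  then show ?case by simp
next
  case (Suc N)
  have "S \<noteq> {}" using Suc.hyps(2) by auto
  then have "Max (key ` S) \<in> key ` S" using Suc.prems(1) by (intro Max_in) simp_all
  then obtain s where s: "s \<in> S" and "key s = Max (key ` S)" by auto
  then have max: "key t \<le> key s" if "t \<in> S" for t using Suc.prems(1) that by simp
  define S' where "S' = S - {s}"
  define R where "R = {v \<in> facet s. \<exists>u\<in>S'. facet s - {v} \<subseteq> facet u}"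
  let ?A = "\<Union>t\<in>S'. Pow (facet t)" and ?V = "\<Union>t\<in>S. facet t"
  have "cm_of_dim K d (?A \<union> Pow (facet s))"
  proof (rule cm_of_dim_Un)
    have V: "finite ?V" using Suc.prems by auto
    show "simplicial ?V ?A" by (rule simplicialI[OF V]) (unfold S'_def, blast+)
    show "simplicial ?V (Pow (facet s))" using V by (rule simplicialI) (use s in auto)
    show "cm_of_dim K d ?A"
    proof (rule Suc.hyps)
      show "N = card S'" using Suc s by (simp add: S'_def)
      show "finite S'" using Suc.prems by (simp add: S'_def)
      show "finite (facet t)" if "t \<in> S'" for t using Suc.prems that by (simp add: S'_def)
      show "int (card (facet t)) = d + 1" if "t \<in> S'" for t using Suc.prems that by (simp add: S'_def)
      fix t t' assume t: "t \<in> S'" "t' \<in> S'" "t' \<noteq> t" "key t' \<le> key t"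
      then obtain v u where "v \<in> facet t - facet t'" "u \<in> S" "key u < key t" "facet t - {v} \<subseteq> facet u"
        using Suc.prems(4)[of t t'] unfolding S'_def by blast
      moreover from this have "u \<noteq> s" using max[of t] t unfolding S'_def by auto
      then have "u \<in> S'" using \<open>u \<in> S\<close> by (simp add: S'_def)
      ultimately show "\<exists>v\<in>facet t - facet t'. \<exists>u\<in>S'. key u < key t \<and> facet t - {v} \<subseteq> facet u"
        by blast
    qed
    show "cm_of_dim K d (Pow (facet s))"
      using cm_of_dim_simplex[of "facet s" K] Suc.prems s by simp
    \<comment> \<open>\<open>R\<close> is the set of vertices \<open>v\<close> such that \<open>facet s - {v}\<close> lies in an earlier facet, the
      restriction of the new facet.\<close>
    have "?A \<inter> Pow (facet s) = {X. X \<subseteq> facet s \<and> \<not> R \<subseteq> X}"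
    proof (intro set_eqI iffI)
      fix X assume "X \<in> ?A \<inter> Pow (facet s)"
      then obtain t where t: "t \<in> S'" "X \<subseteq> facet t" "X \<subseteq> facet s" by auto
      then obtain v u where "v \<in> facet s - facet t" "u \<in> S" "key u < key s" "facet s - {v} \<subseteq> facet u"
        using Suc.prems(4)[OF s, of t] max[of t] unfolding S'_def by blast
      moreover from this have "u \<in> S'" unfolding S'_def by blast
      ultimately have "v \<in> R" "v \<notin> X" using t(2) unfolding R_def by blast+
      then show "X \<in> {X. X \<subseteq> facet s \<and> \<not> R \<subseteq> X}" using t(3) by blast
    next
      fix X assume "X \<in> {X. X \<subseteq> facet s \<and> \<not> R \<subseteq> X}"
      then obtain v where v: "v \<in> R" "v \<notin> X" "X \<subseteq> facet s" by blast
      then obtain u where "u \<in> S'" "facet s - {v} \<subseteq> facet u" unfolding R_def by blast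
      then show "X \<in> ?A \<inter> Pow (facet s)" using v by blast
    qed
    moreover have "R \<subseteq> facet s" by (auto simp: R_def)
    ultimately show "cm_of_dim K (d - 1) (?A \<inter> Pow (facet s))"
      using cm_of_dim_not_above[of "facet s" R K] Suc.prems s by simp
  qed
  moreover have "?A \<union> Pow (facet s) = (\<Union>s\<in>S. Pow (facet s))" using s by (auto simp: S'_def)
  ultimately show ?case by simp
qed

section \<open>The Alexander dual of a graph\<close>

text \<open>The Alexander dual of the complex with vertex set \<open>V\<close> and edges \<open>E\<close>, that is, the family of
complements of nonfaces: a nonface has at least two elements and is not an edge.\<close>

definition graph_dual :: "'a set \<Rightarrow> 'a set set \<Rightarrow> 'a set set" where
  "graph_dual V E = {F. F \<subseteq> V \<and> 2 \<le> card (V - F) \<and> V - F \<notin> E}"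

lemma simplicial_graph_dual:
  assumes "finite V" "\<forall>e\<in>E. card e = 2"
  shows "simplicial V (graph_dual V E)"
proof (rule simplicialI)
  show "finite V" by fact
  show "F \<subseteq> V" if "F \<in> graph_dual V E" for F using that by (simp add: graph_dual_def)
  show "D \<in> graph_dual V E" if F: "F \<in> graph_dual V E" and D: "D \<subseteq> F" for D F
  proof -
    have F': "F \<subseteq> V" "2 \<le> card (V - F)" "V - F \<notin> E" using F by (auto simp: graph_dual_def)
    have sub: "V - F \<subseteq> V - D" "finite (V - D)" using D assms(1) by auto
    then have le: "card (V - F) \<le> card (V - D)" by (intro card_mono)
    moreover have "V - D \<notin> E"
    proof
      assume "V - D \<in> E"
      then have "card (V - D) = 2" using assms(2) by blast
      then have "V - F = V - D" using F'(2) le sub by (intro card_subset_eq) auto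
      then show False using F'(3) \<open>V - D \<in> E\<close> by simp
    qed
    ultimately show ?thesis using F' D by (auto simp: graph_dual_def)
  qed
qed

text \<open>The faces whose complement stays a nonface when \<open>v\<close> is deleted from it form the cone over the
dual of the graph without \<open>v\<close>; all others avoid \<open>v\<close>. The faces avoiding \<open>v\<close> are those whose
complement contains, besides \<open>v\<close>, some vertex other than its at most one neighbour; this is
exactly the second part.\<close>

lemma graph_dual_remove_vertex:
  assumes fin: "finite V" and E: "\<forall>e\<in>E. card e = 2" and v: "v \<in> V"
    and N: "N = {w \<in> V. {v, w} \<in> E}" "card N \<le> 1"
    and L: "L = graph_dual (V - {v}) E" and R: "R = V - {v} - N"
  shows "graph_dual V E = {F. F - {v} \<in> L} \<union> {X. X \<subseteq> V - {v} \<and> \<not> R \<subseteq> X}"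
    and "{F. F - {v} \<in> L} \<inter> {X. X \<subseteq> V - {v} \<and> \<not> R \<subseteq> X} = L"
proof -
  note E = E[rule_format]
  have finN: "finite N" using fin N(1) by simp
  have L_iff: "F \<in> L \<longleftrightarrow> F \<subseteq> V - {v} \<and> 2 \<le> card (V - {v} - F) \<and> V - {v} - F \<notin> E" for F
    unfolding L graph_dual_def by simp
  have L_R: "\<not> R \<subseteq> F" if "F \<in> L" for F
  proof
    assume "R \<subseteq> F"
    then have "V - {v} - F \<subseteq> N" unfolding R by auto
    then have "card (V - {v} - F) \<le> card N" by (rule card_mono[OF finN])
    then have "card (V - {v} - F) \<le> 1" using N(2) by simp
    then show False using that unfolding L_iff by simp
  qed
  show "graph_dual V E = {F. F - {v} \<in> L} \<union> {X. X \<subseteq> V - {v} \<and> \<not> R \<subseteq> X}"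
  proof (intro set_eqI iffI)
    fix F assume "F \<in> graph_dual V E"
    then have F: "F \<subseteq> V" "2 \<le> card (V - F)" "V - F \<notin> E" by (auto simp: graph_dual_def)
    show "F \<in> {F. F - {v} \<in> L} \<union> {X. X \<subseteq> V - {v} \<and> \<not> R \<subseteq> X}"
    proof (cases "v \<in> F")
      case True
      then have "V - {v} - (F - {v}) = V - F" by blast
      then have "F - {v} \<in> L" using F(2,3) F(1) unfolding L_iff by (metis Diff_mono subset_refl)
      then show ?thesis by blast
    next
      case False
      have "\<not> R \<subseteq> F"
      proof
        assume "R \<subseteq> F"
        then have D: "V - {v} - F \<subseteq> N" unfolding R by blast
        have VF: "V - F = insert v (V - {v} - F)" using False v by auto
        then have "card (V - F) = Suc (card (V - {v} - F))" using fin by simp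
        then have "1 \<le> card (V - {v} - F)" using F(2) by simp
        then have DN: "V - {v} - F = N" using D N(2) by (intro card_seteq[OF finN]) simp_all
        then have "card N = 1" using \<open>1 \<le> card (V - {v} - F)\<close> N(2) by simp
        then obtain w where w: "N = {w}" by (rule card_1_singletonE)
        then have "{v, w} \<in> E" using N(1) by blast
        then show False using F(3) unfolding VF DN w by simp
      qed
      then show ?thesis using F False by blast
    qed
  next
    fix F assume "F \<in> {F. F - {v} \<in> L} \<union> {X. X \<subseteq> V - {v} \<and> \<not> R \<subseteq> X}"
    then have "F - {v} \<in> L \<or> F \<subseteq> V - {v} \<and> \<not> R \<subseteq> F" by simp
    moreover have "F - {v} = F" if "v \<notin> F" using that by simp
    ultimately consider "F - {v} \<in> L" "v \<in> F" | "F \<in> L" "v \<notin> F" | "F \<subseteq> V - {v}" "\<not> R \<subseteq> F"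
      by metis
    then show "F \<in> graph_dual V E"
    proof cases
      case 1
      then have "V - {v} - (F - {v}) = V - F" by blast
      then have "2 \<le> card (V - F)" "V - F \<notin> E" "F - {v} \<subseteq> V" using 1(1) unfolding L_iff by auto
      then show ?thesis using v unfolding graph_dual_def by blast
    next
      case 2
      then have "V - F = insert v (V - {v} - F)" using v by blast
      then have "card (V - F) = Suc (card (V - {v} - F))" using fin by simp
      then have "3 \<le> card (V - F)" using 2(1) unfolding L_iff by simp
      then have "2 \<le> card (V - F)" "V - F \<notin> E" using E[of "V - F"] by auto
      then show ?thesis using 2(1) unfolding graph_dual_def L_iff by blast
    next
      case 3
      then obtain r where r: "r \<in> V" "r \<noteq> v" "r \<notin> N" "r \<notin> F" unfolding R by blast
      then have sub: "{v, r} \<subseteq> V - F" "card {v, r} = 2" using 3(1) v by auto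
      moreover have finVF: "finite (V - F)" using fin by simp
      ultimately have "2 \<le> card (V - F)" using card_mono[of "V - F" "{v, r}"] by simp
      moreover have "V - F \<notin> E"
      proof
        assume VF: "V - F \<in> E"
        then have "{v, r} = V - F" using E[OF VF] sub by (intro card_subset_eq[OF finVF]) simp_all
        then have "{v, r} \<in> E" using VF by simp
        then show False using r(1,3) N(1) by simp
      qed
      ultimately show ?thesis using 3(1) unfolding graph_dual_def by blast
    qed
  qed
  show "{F. F - {v} \<in> L} \<inter> {X. X \<subseteq> V - {v} \<and> \<not> R \<subseteq> X} = L"
  proof (intro set_eqI iffI)
    fix F assume "F \<in> {F. F - {v} \<in> L} \<inter> {X. X \<subseteq> V - {v} \<and> \<not> R \<subseteq> X}"
    moreover from this have "F - {v} = F" by blast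
    ultimately show "F \<in> L" by simp
  next
    fix F assume F: "F \<in> L"
    then have "F \<subseteq> V - {v}" by (simp add: L_iff)
    moreover from this have "F - {v} = F" by blast
    ultimately show "F \<in> {F. F - {v} \<in> L} \<inter> {X. X \<subseteq> V - {v} \<and> \<not> R \<subseteq> X}"
      using F L_R[OF F] by simp
  qed
qed

text \<open>The last hypothesis is the combinatorial form of being a forest: every nonempty induced subgraph
has a vertex of degree at most one. The proof removes such vertices one at a time.\<close>

lemma cm_graph_dual_forest:
  fixes K :: "'k::field itself"
  assumes "finite V" and E: "\<forall>e\<in>E. card e = 2"
    and "\<And>W. W \<subseteq> V \<Longrightarrow> W \<noteq> {} \<Longrightarrow> \<exists>v\<in>W. card {w \<in> W. {v, w} \<in> E} \<le> 1"
  shows "cm_of_dim K (int (card V) - 3) (graph_dual V E)"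
  using assms(1,3)
proof (induction "card V" arbitrary: V)
  case 0
  then show ?case by (simp add: graph_dual_def)
next
  case (Suc k)
  have "V \<noteq> {}" using Suc.hyps(2) by auto
  then obtain v where v: "v \<in> V" "card {w \<in> V. {v, w} \<in> E} \<le> 1" using Suc.prems(2) by blast
  define N where "N = {w \<in> V. {v, w} \<in> E}"
  define L where "L = graph_dual (V - {v}) E"
  define R where "R = V - {v} - N"
  note dec = graph_dual_remove_vertex[OF Suc.prems(1) E v(1) N_def v(2)[folded N_def] L_def R_def]
  have k: "k = card (V - {v})" using Suc.hyps(2) Suc.prems(1) v(1) by simp
  then have card: "int (card V) = int (card (V - {v})) + 1" using Suc.hyps(2) by simp
  have cmL: "cm_of_dim K (int (card (V - {v})) - 3) L"
    unfolding L_def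
  proof (rule Suc.hyps(1)[OF k])
    show "finite (V - {v})" using Suc.prems(1) by simp
    show "\<exists>v\<in>W. card {w \<in> W. {v, w} \<in> E} \<le> 1" if "W \<subseteq> V - {v}" "W \<noteq> {}" for W
      using Suc.prems(2)[of W] that by blast
  qed
  have L: "simplicial (V - {v}) L"
    unfolding L_def using Suc.prems(1) E by (intro simplicial_graph_dual) simp_all
  show ?case
    unfolding dec(1)
  proof (rule cm_of_dim_Un)
    show "simplicial V {F. F - {v} \<in> L}"
    proof (rule simplicialI)
      show "finite V" by fact
      show "F \<subseteq> V" if "F \<in> {F. F - {v} \<in> L}" for F
        using simplicialD(2)[OF L, of "F - {v}"] that v(1) by auto
      show "D \<in> {F. F - {v} \<in> L}" if "F \<in> {F. F - {v} \<in> L}" "D \<subseteq> F" for D F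
        using simplicialD(3)[OF L, of "F - {v}" "D - {v}"] that by auto
    qed
    show "simplicial V {X. X \<subseteq> V - {v} \<and> \<not> R \<subseteq> X}"
      using Suc.prems(1) by (intro simplicial_mono_verts[OF simplicial_not_above]) auto
    have "v \<notin> F" if "F \<in> L" for F using simplicialD(2)[OF L that] by blast
    then show "cm_of_dim K (int (card V) - 3) {F. F - {v} \<in> L}"
      using cmL by (intro cm_of_dim_cone[OF L]) (simp_all add: card)
    show "cm_of_dim K (int (card V) - 3) {X. X \<subseteq> V - {v} \<and> \<not> R \<subseteq> X}"
      using cm_of_dim_not_above[of "V - {v}" R K] Suc.prems(1) by (simp add: card R_def)
    show "cm_of_dim K (int (card V) - 3 - 1) ({F. F - {v} \<in> L} \<inter> {X. X \<subseteq> V - {v} \<and> \<not> R \<subseteq> X})"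
      unfolding dec(2) using cmL by (simp add: card)
  qed
qed

text \<open>An orientation of a simplex, built up by joining vertices.\<close>

lemma simplex_chain_exists:
  assumes "finite F"
  shows "\<exists>c :: 'a list \<Rightarrow> 'k::field. c \<in> oriented_chains (Pow F) (int (card F) - 1) \<and>
    (\<forall>xs. distinct xs \<longrightarrow> set xs = F \<longrightarrow> c xs \<noteq> 0)"
  using assms
proof induction
  case empty
  have "(\<lambda>xs. if xs = [] then 1 else 0) \<in> oriented_chains (Pow {}) (int (card {}) - 1)"
    by (rule chainI) (auto split: if_splits)
  then show ?case by (intro exI[of _ "\<lambda>xs. if xs = [] then 1 else 0"]) auto
next
  case (insert v F)
  then obtain c :: "'a list \<Rightarrow> 'k" where c: "c \<in> oriented_chains (Pow F) (int (card F) - 1)"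
    and c_nz: "\<And>xs. distinct xs \<Longrightarrow> set xs = F \<Longrightarrow> c xs \<noteq> 0" by auto
  have "cone_chain v c \<in> oriented_chains (Pow (insert v F)) (int (card F))"
  proof (rule chainI)
    fix xs assume "cone_chain v c xs \<noteq> 0"
    then have xs: "distinct xs" "v \<in> set xs" "c (remove1 v xs) \<noteq> 0"
      by (auto simp: cone_chain_def split: if_splits)
    have "length xs = Suc (length (remove1 v xs))"
      using length_pos_if_in_set[OF xs(2)] xs(2) by (simp add: length_remove1)
    moreover have "set (remove1 v xs) \<subseteq> F" "int (length (remove1 v xs)) = int (card F)"
      using chainD(2,3)[OF c xs(3)] by auto
    ultimately show "distinct xs \<and> set xs \<in> Pow (insert v F) \<and> int (length xs) = int (card F) + 1"
      using xs(1) by auto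
  qed (rule cone_chain_swap[OF c])
  moreover have "cone_chain v c xs \<noteq> 0" if d: "distinct xs" and s: "set xs = insert v F" for xs
  proof -
    obtain ps qs where xs: "xs = ps @ v # qs" using s by (metis insertI1 split_list)
    have "set (ps @ qs) = F" using s d insert.hyps(2) unfolding xs by auto
    then have "c (ps @ qs) \<noteq> 0" using d unfolding xs by (intro c_nz) auto
    then show ?thesis using cone_chain_split[of ps v qs c] d unfolding xs by simp
  qed
  ultimately show ?case using insert.hyps by (intro exI[of _ "cone_chain v c"]) simp
qed

text \<open>Let \<open>{a, b}\<close> be the closing edge of the cycle. The simplex on \<open>V - {a, b}\<close> is not in the dual
but its boundary is, since sets of codimension \<open>3\<close> are faces. If that boundary were the boundary
of a chain \<open>w\<close> of the dual, then the simplex minus \<open>w\<close> would be a cycle of the full simplex on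
\<open>V\<close>, hence the boundary of a chain \<open>t\<close> supported on sets \<open>V - {p}\<close>. Up to sign, \<open>t\<close> assigns a
number to each vertex \<open>p\<close>, and its boundary at \<open>V - {p, q}\<close> compares the numbers of \<open>p\<close> and \<open>q\<close>.
They agree for each edge other than \<open>{a, b}\<close>, because neither the simplex nor \<open>w\<close> has a
coefficient there; along the cycle they therefore agree for \<open>a\<close> and \<open>b\<close>, contradicting the
coefficient of the simplex at \<open>V - {a, b}\<close>.\<close>

lemma graph_dual_cycle_homology:
  fixes K :: "'k::field itself"
  assumes fin: "finite V" and E: "\<forall>e\<in>E. card e = 2" and cyc: "is_cycle (V, E) c"
  shows "\<not> reduced_homology_vanishes K (graph_dual V E) (int (card V) - 4)"
proof
  let ?\<Delta> = "graph_dual V E" and ?N = "int (card V)" and ?m = "length c"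
  assume van: "reduced_homology_vanishes K ?\<Delta> (?N - 4)"
  have \<Delta>: "simplicial V ?\<Delta>" by (rule simplicial_graph_dual[OF fin E])
  note E = E[rule_format]
  have PV: "simplicial V (Pow V)" using fin by (auto intro: simplicialI)
  have c: "3 \<le> ?m" "distinct c" "set c \<subseteq> V" "cycle_edges c \<subseteq> E"
    using cyc by (auto simp: is_cycle_def)
  define a where "a = c ! 0"
  define b where "b = c ! (?m - 1)"
  have edge: "{c ! k, c ! Suc k} \<in> E" if "Suc k < ?m" for k
  proof -
    have "{c ! k, c ! (Suc k mod ?m)} \<in> cycle_edges c" using that unfolding cycle_edges_def by force
    then show ?thesis using that c(4) by auto
  qed
  have ab: "{a, b} \<in> E"
  proof -
    have "{c ! (?m - 1), c ! (Suc (?m - 1) mod ?m)} \<in> cycle_edges c"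
      using c(1) unfolding cycle_edges_def by force
    moreover have "Suc (?m - 1) mod ?m = 0" using c(1) by (cases c) auto
    ultimately show ?thesis using c(4) by (auto simp: a_def b_def insert_commute)
  qed
  have inV: "c ! k \<in> V" if "k < ?m" for k using that c(3) by auto
  have abV: "a \<in> V" "b \<in> V" unfolding a_def b_def by (rule inV, use c(1) in linarith)+
  have neq: "c ! j \<noteq> c ! k" if "j < k" "k < ?m" for j k
    using that c(2) by (simp add: nth_eq_iff_index_eq)
  have "a \<noteq> b" using E[OF ab] by (cases "a = b") auto
  then have cardZ: "int (card (V - {a, b})) = ?N - 2"
  proof -
    have "card (V - {a, b}) + card {a, b} = card V"
      using abV fin by (simp add: card_Diff_subset card_mono)
    then show ?thesis using \<open>a \<noteq> b\<close> by simp
  qed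
  obtain z0 :: "'a list \<Rightarrow> 'k" where z0: "z0 \<in> oriented_chains (Pow (V - {a, b})) (?N - 3)"
    and z0_nz: "\<And>xs. distinct xs \<Longrightarrow> set xs = V - {a, b} \<Longrightarrow> z0 xs \<noteq> 0"
    using simplex_chain_exists[of "V - {a, b}", where 'k = 'k] fin cardZ by auto
  have z0V: "z0 \<in> oriented_chains (Pow V) (?N - 3)" by (rule chain_mono[OF z0]) auto
  have z: "boundary_on V z0 \<in> oriented_chains ?\<Delta> (?N - 4)"
  proof (rule chainI)
    fix xs assume nz: "boundary_on V z0 xs \<noteq> 0"
    note xs = chainD[OF boundary_on_chain[OF PV z0V] nz]
    have "int (card (set xs)) = ?N - 3" using xs by (simp add: distinct_card)
    moreover have "card (V - set xs) + card (set xs) = card V"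
      using xs(2) fin by (simp add: card_Diff_subset card_mono)
    ultimately have "card (V - set xs) = 3" by linarith
    then have "set xs \<in> ?\<Delta>" using xs(2) E[of "V - set xs"] by (auto simp: graph_dual_def)
    then show "distinct xs \<and> set xs \<in> ?\<Delta> \<and> int (length xs) = ?N - 4 + 1" using xs by simp
  qed (rule chain_swap[OF boundary_on_chain[OF PV z0V]])
  then obtain w where w: "w \<in> oriented_chains ?\<Delta> (?N - 3)" "boundary_on V w = boundary_on V z0"
    using van boundary_on_boundary_on[OF PV z0V] unfolding vanishes_iff[OF \<Delta>] by force
  define u where "u = (\<lambda>xs. z0 xs - w xs)"
  have "w \<in> oriented_chains (Pow V) (?N - 3)"
    using w(1) by (rule chain_mono) (auto simp: graph_dual_def)
  then have "u \<in> oriented_chains (Pow V) (?N - 3)" unfolding u_def by (intro chain_diff z0V)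
  moreover have "boundary_on V u = (\<lambda>_. 0)" unfolding u_def by (simp add: boundary_on_diff w)
  moreover have "reduced_homology_vanishes K (Pow V) (?N - 3)"
    using abV by (intro vanishes_cone[OF PV]) auto
  ultimately obtain t where t: "t \<in> oriented_chains (Pow V) (?N - 2)" "boundary_on V t = u"
    unfolding vanishes_iff[OF PV] by force
  have u_eq: "u xs = t (p # xs) + t (q # xs)"
    if "distinct xs" "set xs = V - {p, q}" "p \<in> V" "q \<in> V" "p \<noteq> q" for p q xs
  proof -
    have "(\<Sum>v\<in>V. t (v # xs)) = (\<Sum>v\<in>{p, q}. t (v # xs))"
    proof (rule sum.mono_neutral_right)
      show "\<forall>v\<in>V - {p, q}. t (v # xs) = 0"
      proof
        fix v assume "v \<in> V - {p, q}"
        then have "\<not> distinct (v # xs)" using that by simp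
        then show "t (v # xs) = 0" using chainD(1)[OF t(1)] by blast
      qed
    qed (use fin that in auto)
    then show ?thesis using that(5) unfolding t(2)[symmetric] boundary_on_def by simp
  qed
  have w0: "w xs = 0" if "set xs = V - {p, q}" "p \<in> V" "q \<in> V" "{p, q} \<in> E" for p q xs
  proof (rule ccontr)
    assume "w xs \<noteq> 0"
    then have "V - set xs \<notin> E" using chainD(2)[OF w(1)] by (auto simp: graph_dual_def)
    moreover have "V - set xs = {p, q}" using that by auto
    ultimately show False using that by simp
  qed
  \<comment> \<open>Equality of the numbers that \<open>t\<close> assigns to \<open>p\<close> and \<open>q\<close>, written without choosing
    orientations. Its transitivity comes from the alternation of \<open>t\<close>.\<close>
  define rel where "rel p q \<longleftrightarrow>
    (\<forall>xs. distinct xs \<longrightarrow> set xs = V - {p, q} \<longrightarrow> t (p # xs) + t (q # xs) = 0)" for p q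
  have rel_edge: "rel p q" if e: "{p, q} \<in> E" and pq: "p \<in> V" "q \<in> V" "{p, q} \<noteq> {a, b}" for p q
    unfolding rel_def
  proof (intro allI impI)
    fix xs assume xs: "distinct xs" "set xs = V - {p, q}"
    have ne: "p \<noteq> q" using E[OF e] by (cases "p = q") auto
    have "z0 xs = 0"
    proof (rule ccontr)
      assume "z0 xs \<noteq> 0"
      then have "V - {p, q} \<subseteq> V - {a, b}" using chainD(2)[OF z0] xs by auto
      then have "{a, b} \<subseteq> {p, q}" using abV by blast
      then show False using pq(3) \<open>a \<noteq> b\<close> by auto
    qed
    then have "u xs = 0" using w0[OF xs(2) pq(1,2) e] by (simp add: u_def)
    then show "t (p # xs) + t (q # xs) = 0" using u_eq[OF xs pq(1,2) ne] by simp
  qed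
  have rel_trans: "rel p r"
    if pqr: "p \<in> V" "q \<in> V" "r \<in> V" "p \<noteq> q" "q \<noteq> r" "p \<noteq> r" and rel: "rel p q" "rel q r" for p q r
    unfolding rel_def
  proof (intro allI impI)
    fix xs assume xs: "distinct xs" "set xs = V - {p, r}"
    then have "q \<in> set xs" using pqr by auto
    then obtain ps qs where sp: "xs = ps @ q # qs" by (meson split_list)
    let ?ys = "ps @ qs"
    have ys: "distinct ?ys" "set ?ys = V - {p, q, r}" using xs unfolding sp by auto
    \<comment> \<open>Moving \<open>q\<close> to the front reduces the claim to enumerations of \<open>V - {p, q, r}\<close>.\<close>
    have mv: "t (x # xs) = (-1) ^ Suc (length ps) * t (q # x # ?ys)" for x
      using chain_move_to_front[OF t(1), of "x # ps" q qs] by (simp add: sp)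
    have "distinct (r # ?ys)" "set (r # ?ys) = V - {p, q}" using ys pqr by auto
    then have 1: "t (p # r # ?ys) + t (q # r # ?ys) = 0" using rel(1) unfolding rel_def by blast
    have "distinct (p # ?ys)" "set (p # ?ys) = V - {q, r}" using ys pqr by auto
    then have 2: "t (q # p # ?ys) + t (r # p # ?ys) = 0" using rel(2) unfolding rel_def by blast
    have 3: "t (p # r # ?ys) = - t (r # p # ?ys)" using chain_swap[OF t(1), of "[]" p r ?ys] by simp
    have "t (q # p # ?ys) + t (q # r # ?ys) =
        (t (p # r # ?ys) + t (q # r # ?ys)) + (t (q # p # ?ys) + t (r # p # ?ys))"
      unfolding 3 by simp
    then have "t (q # p # ?ys) + t (q # r # ?ys) = 0" unfolding 1 2 by simp
    then show "t (p # xs) + t (r # xs) = 0" unfolding mv by (simp only: distrib_left[symmetric] mult_zero_right)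
  qed
  have "rel a (c ! Suc k)" if "Suc k < ?m" for k
    using that
  proof (induction k)
    case 0
    have "c ! Suc 0 \<noteq> a" "c ! Suc 0 \<noteq> b" using neq[of 0 "Suc 0"] neq[of "Suc 0" "?m - 1"] c(1)
      by (auto simp: a_def b_def)
    then have "{c ! 0, c ! Suc 0} \<noteq> {a, b}" by auto
    then show ?case
      using rel_edge[of "c ! 0" "c ! Suc 0"] edge[OF 0] inV[OF 0] abV(1) unfolding a_def by blast
  next
    case (Suc k)
    have na: "a \<noteq> c ! Suc k" "a \<noteq> c ! Suc (Suc k)"
      using neq[of 0] Suc.prems by (auto simp: a_def)
    then have "{c ! Suc k, c ! Suc (Suc k)} \<noteq> {a, b}" by auto
    then have "rel (c ! Suc k) (c ! Suc (Suc k))"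
      using rel_edge edge[OF Suc.prems] inV[OF Suc.prems] inV[of "Suc k"] Suc.prems by simp
    moreover have "rel a (c ! Suc k)" using Suc by simp
    ultimately show ?case
      using rel_trans[of a "c ! Suc k" "c ! Suc (Suc k)"] na abV(1) inV[OF Suc.prems] inV[of "Suc k"]
        neq[of "Suc k" "Suc (Suc k)"] Suc.prems by simp
  qed
  then have "rel a (c ! Suc (?m - 2))" using c(1) by simp
  moreover have "Suc (?m - 2) = ?m - 1" using c(1) by linarith
  ultimately have "rel a b" unfolding b_def by metis
  moreover obtain xs where xs: "set xs = V - {a, b}" "distinct xs"
    using finite_distinct_list[of "V - {a, b}"] fin by auto
  ultimately have "u xs = 0" using u_eq[OF xs(2,1) abV \<open>a \<noteq> b\<close>] by (simp add: rel_def)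
  then show False using z0_nz[OF xs(2,1)] w0[OF xs(1) abV ab] by (simp add: u_def)
qed

section \<open>Whisker graphs and matchings\<close>

lemma finite_simple_graphD:
  assumes "finite_simple_graph H"
  shows "finite (verts H)" "e \<in> edges H \<Longrightarrow> e \<subseteq> verts H" "e \<in> edges H \<Longrightarrow> card e = 2"
    "{a, b} \<in> edges H \<Longrightarrow> a \<noteq> b" "{a, b} \<in> edges H \<Longrightarrow> a \<in> verts H"
  using assms unfolding finite_simple_graph_def by (auto simp: card_2_iff doubleton_eq_iff)

lemma verts_whisker [simp]: "verts (whisker H) = verts H <+> verts H"
  by (simp add: whisker_def)

lemma whisker_edge_cases:
  assumes "e \<in> edges (whisker H)"
  obtains (base) d where "d \<in> edges H" "e = Inl ` d"
  | (whisk) x where "x \<in> verts H" "e = {Inl x, Inr x}"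
  using assms unfolding whisker_def by auto

lemma whisker_edges: "d \<in> edges H \<Longrightarrow> Inl ` d \<in> edges (whisker H)"
  "x \<in> verts H \<Longrightarrow> {Inl x, Inr x} \<in> edges (whisker H)"
  by (auto simp: whisker_def)

lemma finite_simple_graph_whisker:
  assumes "finite_simple_graph H" shows "finite_simple_graph (whisker H)"
  unfolding finite_simple_graph_def
proof (rule conjI; (rule ballI)?)
  show "finite (verts (whisker H))" using finite_simple_graphD(1)[OF assms] by simp
  fix e assume "e \<in> edges (whisker H)"
  then show "e \<subseteq> verts (whisker H) \<and> card e = 2"
  proof (cases rule: whisker_edge_cases)
    case (base d)
    then show ?thesis using finite_simple_graphD(2,3)[OF assms base(1)] by (auto simp: card_image)
  qed auto
qed

lemma simplicial_matching_free:
  assumes "finite (verts G)" shows "simplicial (verts G) (matching_free_complex q G)"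
proof (rule simplicialI)
  show "finite (verts G)" by fact
  show "F \<subseteq> verts G" if "F \<in> matching_free_complex q G" for F
    using that by (simp add: matching_free_complex_def)
  show "D \<in> matching_free_complex q G" if F: "F \<in> matching_free_complex q G" and D: "D \<subseteq> F" for D F
  proof -
    have "is_matching (induced_subgraph G F) M" if "is_matching (induced_subgraph G D) M" for M
      using that D unfolding is_matching_def induced_subgraph_def by auto
    then show ?thesis using F D unfolding matching_free_complex_def by auto
  qed
qed

lemma matching_free_2_iff:
  "F \<in> matching_free_complex 2 G \<longleftrightarrow> F \<subseteq> verts G \<and>
     (\<forall>e\<in>edges G. \<forall>f\<in>edges G. e \<subseteq> F \<longrightarrow> f \<subseteq> F \<longrightarrow> e \<noteq> f \<longrightarrow> e \<inter> f \<noteq> {})"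
proof -
  have "(\<exists>M. is_matching (induced_subgraph G F) M \<and> card M = 2) \<longleftrightarrow>
      (\<exists>e\<in>edges G. \<exists>f\<in>edges G. e \<subseteq> F \<and> f \<subseteq> F \<and> e \<noteq> f \<and> e \<inter> f = {})" (is "?L \<longleftrightarrow> ?R")
  proof
    assume ?L
    then obtain M where M: "is_matching (induced_subgraph G F) M" "card M = 2" by blast
    then obtain e f where ef: "e \<in> M" "f \<in> M" "e \<noteq> f" unfolding card_2_iff by blast
    have "M \<subseteq> {e \<in> edges G. e \<subseteq> F}" "pairwise disjnt M"
      using M(1) by (simp_all add: is_matching_def induced_subgraph_def)
    moreover from this(2) have "e \<inter> f = {}" using ef unfolding pairwise_def disjnt_def by blast
    ultimately show ?R using ef by blast
  next
    assume ?R
    then obtain e f where ef: "e \<in> edges G" "f \<in> edges G" "e \<subseteq> F" "f \<subseteq> F" "e \<noteq> f" "e \<inter> f = {}"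
      by blast
    have "pairwise disjnt {e, f}" using ef(6) by (simp add: pairwise_insert disjnt_def Int_commute)
    then have "is_matching (induced_subgraph G F) {e, f} \<and> card {e, f} = 2"
      using ef unfolding is_matching_def induced_subgraph_def by simp
    then show ?L by blast
  qed
  then show ?thesis unfolding matching_free_complex_def by blast
qed

lemma induced_triangle_iff:
  assumes H: "finite_simple_graph H"
  shows "(\<exists>c. is_induced_cycle H c \<and> length c = 3) \<longleftrightarrow>
    (\<exists>x y z. {x, y} \<in> edges H \<and> {y, z} \<in> edges H \<and> {z, x} \<in> edges H)"
proof -
  have cyc: "cycle_edges [x, y, z] = {{x, y}, {y, z}, {z, x}}" for x y z :: 'a
  proof -
    have img: "cycle_edges c = (\<lambda>i. {c ! i, c ! (Suc i mod length c)}) ` {..<length c}" for c :: "'a list"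
      unfolding cycle_edges_def by (simp only: setcompr_eq_image lessThan_def)
    have "{..<length [x, y, z]} = {0, 1, 2}" by auto
    then show ?thesis unfolding img by (simp only: image_insert image_empty) simp
  qed
  show ?thesis
  proof
    assume "\<exists>c. is_induced_cycle H c \<and> length c = 3"
    then obtain c where c: "is_induced_cycle H c" "length c = 3" by blast
    obtain x y z where "c = [x, y, z]"
      using c(2) by (auto simp: numeral_3_eq_3 length_Suc_conv)
    then have "{{x, y}, {y, z}, {z, x}} \<subseteq> edges H"
      using c(1) cyc unfolding is_induced_cycle_def is_cycle_def by metis
    then show "\<exists>x y z. {x, y} \<in> edges H \<and> {y, z} \<in> edges H \<and> {z, x} \<in> edges H" by blast
  next
    assume "\<exists>x y z. {x, y} \<in> edges H \<and> {y, z} \<in> edges H \<and> {z, x} \<in> edges H"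
    then obtain x y z where e: "{x, y} \<in> edges H" "{y, z} \<in> edges H" "{z, x} \<in> edges H" by blast
    have d: "x \<noteq> y" "y \<noteq> z" "z \<noteq> x" using finite_simple_graphD(4)[OF H] e by blast+
    have v: "x \<in> verts H" "y \<in> verts H" "z \<in> verts H" using finite_simple_graphD(5)[OF H] e by blast+
    have "is_cycle H [x, y, z]" using e d v unfolding is_cycle_def cyc by auto
    moreover have "edges (induced_subgraph H {x, y, z}) = {{x, y}, {y, z}, {z, x}}"
    proof
      show "edges (induced_subgraph H {x, y, z}) \<subseteq> {{x, y}, {y, z}, {z, x}}"
      proof
        fix f assume "f \<in> edges (induced_subgraph H {x, y, z})"
        then have f: "f \<in> edges H" "f \<subseteq> {x, y, z}" by (auto simp: induced_subgraph_def)
        then obtain p q where "f = {p, q}" "p \<noteq> q" using finite_simple_graphD(3)[OF H f(1)] by (auto simp: card_2_iff)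
        then show "f \<in> {{x, y}, {y, z}, {z, x}}" using f(2) by auto
      qed
      show "{{x, y}, {y, z}, {z, x}} \<subseteq> edges (induced_subgraph H {x, y, z})"
        using e by (simp add: induced_subgraph_def)
    qed
    ultimately have "is_induced_cycle H [x, y, z]" unfolding is_induced_cycle_def cyc by simp
    then show "\<exists>c. is_induced_cycle H c \<and> length c = 3" by (intro exI[of _ "[x, y, z]"]) simp
  qed
qed

lemma girth_infinite_iff: "girth G = \<infinity> \<longleftrightarrow> \<not> (\<exists>c. is_cycle G c)"
proof
  assume inf: "girth G = \<infinity>"
  show "\<not> (\<exists>c. is_cycle G c)"
  proof
    assume "\<exists>c. is_cycle G c"
    then obtain c where "is_cycle G c" by blast
    then have "girth G \<le> enat (length c)" unfolding girth_def by (intro INF_lower) simp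
    then show False using inf by simp
  qed
qed (simp add: girth_def Inf_enat_def)

section \<open>Faces without two disjoint edges\<close>

text \<open>In the link of \<open>\<sigma>\<close>, consisting of \<open>x\<close>, \<open>y\<close> and the whiskers outside the triangle, the vertex \<open>z\<close>
is isolated: adding \<open>z\<close> together with any further vertex creates a whisker edge disjoint from
one of the sides of the triangle. But the link also has an edge, formed by the whiskers at \<open>x\<close>
and \<open>z\<close>.\<close>

lemma matching_free_2_not_cm:
  fixes K :: "'k::field itself"
  assumes H: "finite_simple_graph H"
    and xyz: "{x, y} \<in> edges H" "{y, z} \<in> edges H" "{z, x} \<in> edges H"
  shows "\<not> cohen_macaulay K (matching_free_complex 2 (whisker H))"
proof
  let ?\<Delta> = "matching_free_complex 2 (whisker H)"
  assume cm: "cohen_macaulay K ?\<Delta>"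
  have \<Delta>: "simplicial (verts (whisker H)) ?\<Delta>"
    by (rule simplicial_matching_free) (simp add: finite_simple_graphD(1)[OF H])
  have d: "x \<noteq> y" "y \<noteq> z" "z \<noteq> x" using finite_simple_graphD(4)[OF H] xyz by blast+
  have v: "x \<in> verts H" "y \<in> verts H" "z \<in> verts H" using finite_simple_graphD(5)[OF H] xyz by blast+
  define T where "T = verts H - {x, y, z}"
  define \<sigma> :: "('a + 'a) set" where "\<sigma> = {Inl x, Inl y} \<union> Inr ` T"
  have TV: "T \<subseteq> verts H" by (auto simp: T_def)
  have centre: "\<sigma> \<union> {Inr x, Inr z} \<in> ?\<Delta>"
  proof -
    have "Inl x \<in> e" if "e \<in> edges (whisker H)" "e \<subseteq> \<sigma> \<union> {Inr x, Inr z}" for e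
      using that(1)
    proof (cases rule: whisker_edge_cases)
      case (base f)
      then have "f \<subseteq> {x, y}" using that(2) by (auto simp: \<sigma>_def)
      moreover have "card {x, y} = card f" using finite_simple_graphD(3)[OF H base(1)] d by simp
      ultimately have "f = {x, y}" by (intro card_subset_eq) simp_all
      then show ?thesis using base by simp
    next
      case (whisk a)
      then have "a = x" using that(2) d by (auto simp: \<sigma>_def T_def)
      then show ?thesis using whisk by simp
    qed
    moreover have "\<sigma> \<union> {Inr x, Inr z} \<subseteq> verts (whisker H)" using v TV by (auto simp: \<sigma>_def)
    ultimately show ?thesis unfolding matching_free_2_iff by blast
  qed
  have triangle: "\<sigma> \<union> {Inl z} \<in> ?\<Delta>"
  proof -
    have sub: "\<exists>f \<subseteq> {x, y, z}. card f = 2 \<and> e = Inl ` f"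
      if "e \<in> edges (whisker H)" "e \<subseteq> \<sigma> \<union> {Inl z}" for e
      using that(1)
    proof (cases rule: whisker_edge_cases)
      case (base f)
      then have "f \<subseteq> {x, y, z}" using that(2) by (auto simp: \<sigma>_def)
      then show ?thesis using base finite_simple_graphD(3)[OF H base(1)] by blast
    next
      case (whisk a)
      then show ?thesis using that(2) by (auto simp: \<sigma>_def T_def)
    qed
    have pairs: "f \<inter> g \<noteq> {}" if fg: "f \<subseteq> {x, y, z}" "g \<subseteq> {x, y, z}" "card f = 2" "card g = 2" for f g
    proof
      assume "f \<inter> g = {}"
      moreover have "finite f" "finite g" using fg by (auto intro: finite_subset)
      ultimately have "card (f \<union> g) = 4" using fg by (simp add: card_Un_disjoint)
      moreover have "card (f \<union> g) \<le> card {x, y, z}" using fg by (intro card_mono) auto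
      ultimately show False using d by simp
    qed
    have "e \<inter> e' \<noteq> {}" if ee: "e \<in> edges (whisker H)" "e' \<in> edges (whisker H)"
      "e \<subseteq> \<sigma> \<union> {Inl z}" "e' \<subseteq> \<sigma> \<union> {Inl z}" for e e'
    proof -
      obtain f where f: "f \<subseteq> {x, y, z}" "card f = 2" "e = Inl ` f" using sub[OF ee(1,3)] by blast
      obtain g where g: "g \<subseteq> {x, y, z}" "card g = 2" "e' = Inl ` g" using sub[OF ee(2,4)] by blast
      have "e \<inter> e' = Inl ` (f \<inter> g)" unfolding f(3) g(3) by (simp add: image_Int)
      then show ?thesis using pairs[OF f(1) g(1) f(2) g(2)] by simp
    qed
    moreover have "\<sigma> \<union> {Inl z} \<subseteq> verts (whisker H)" using v TV by (auto simp: \<sigma>_def)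
    ultimately show ?thesis unfolding matching_free_2_iff by blast
  qed
  have isolated: "{w, Inl z} \<notin> link ?\<Delta> \<sigma>" if w: "w \<noteq> Inl z" for w
  proof
    assume "{w, Inl z} \<in> link ?\<Delta> \<sigma>"
    then have F: "{w, Inl z} \<union> \<sigma> \<in> ?\<Delta>" "w \<notin> \<sigma>" by (auto simp: link_def)
    let ?F = "{w, Inl z} \<union> \<sigma>"
    have meet: "e \<inter> f \<noteq> {}" if "e \<in> edges (whisker H)" "f \<in> edges (whisker H)" "e \<subseteq> ?F" "f \<subseteq> ?F" "e \<noteq> f"
      for e f using F(1) that unfolding matching_free_2_iff by blast
    have wV: "w \<in> verts H <+> verts H" using simplicialD(2)[OF \<Delta> F(1)] by simp
    obtain a f where af: "a \<in> verts H" "{Inl a, Inr a} \<subseteq> ?F" "f \<in> edges H" "f \<subseteq> {x, y, z}" "a \<notin> f"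
    proof (cases w)
      case (Inl a)
      then have "a \<in> verts H" "a \<notin> {x, y, z}" using wV w F(2) by (auto simp: \<sigma>_def)
      then show thesis using that[of a "{x, y}"] xyz Inl by (simp add: \<sigma>_def T_def)
    next
      case (Inr a)
      then have "a \<in> {x, y, z}" using wV F(2) by (auto simp: \<sigma>_def T_def)
      then consider "a = x" | "a = y" | "a = z" by blast
      then show thesis
      proof cases
        case 1 then show thesis using that[of x "{y, z}"] xyz Inr v d by (simp add: \<sigma>_def)
      next
        case 2 then show thesis using that[of y "{z, x}"] xyz Inr v d by (simp add: \<sigma>_def)
      next
        case 3 then show thesis using that[of z "{x, y}"] xyz Inr v d by (simp add: \<sigma>_def)
      qed
    qed
    have "Inl ` f \<subseteq> ?F" using af(4) by (auto simp: \<sigma>_def)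
    moreover have "{Inl a, Inr a} \<inter> Inl ` f = {}" using af(5) by auto
    ultimately show False
      using meet[OF whisker_edges(2)[OF af(1)] whisker_edges(1)[OF af(3)]] af(2) by auto
  qed
  have \<sigma>: "\<sigma> \<in> ?\<Delta>" using simplicialD(3)[OF \<Delta> triangle] by blast
  have edge: "{Inr x, Inr z} \<in> link ?\<Delta> \<sigma>"
    using centre by (auto simp: link_def Un_commute \<sigma>_def T_def)
  have "reduced_homology_vanishes K (link ?\<Delta> \<sigma>) 0"
    by (rule cohen_macaulayD[OF cm \<Delta> \<sigma> edge]) (use d in simp)
  moreover have "{Inl z} \<in> link ?\<Delta> \<sigma>"
    using triangle d by (auto simp: link_def Un_commute \<sigma>_def T_def)
  moreover have "{Inr x} \<in> link ?\<Delta> \<sigma>"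
    using simplicialD(3)[OF simplicial_link[OF \<Delta>] edge] by blast
  ultimately show False
    using isolated_vertex_homology[OF simplicial_link[OF \<Delta>], of "Inl z" \<sigma> "Inr x"] isolated by blast
qed

text \<open>The label \<open>(x, A)\<close> stands for the face with centre \<open>x\<close>, remaining base vertices \<open>A\<close> and all
whiskers outside \<open>A\<close>, the one at \<open>x\<close> included.\<close>

definition star_facet :: "'a graph \<Rightarrow> 'a \<times> 'a set \<Rightarrow> ('a + 'a) set" where
  "star_facet H s = Inl ` insert (fst s) (snd s) \<union> Inr ` (verts H - snd s)"

definition star_facet_labels :: "'a graph \<Rightarrow> ('a \<times> 'a set) set" where
  "star_facet_labels H = {(x, A). x \<in> verts H \<and> A \<subseteq> verts H - {x} \<and> (\<forall>e\<in>edges H. \<not> e \<subseteq> A)}"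

text \<open>Pairwise intersecting edges form a star or a triangle. A whisker edge in \<open>F\<close> can be met only at
its base vertex, which is then the centre; otherwise all edges come from \<open>H\<close>, where triangles
are excluded.\<close>

lemma star_centre:
  assumes H: "finite_simple_graph H" and ne: "verts H \<noteq> {}"
    and tf: "\<not> (\<exists>x y z. {x, y} \<in> edges H \<and> {y, z} \<in> edges H \<and> {z, x} \<in> edges H)"
    and F: "F \<in> matching_free_complex 2 (whisker H)"
  shows "\<exists>x\<in>verts H. \<forall>e\<in>edges (whisker H). e \<subseteq> F \<longrightarrow> Inl x \<in> e"
proof -
  have meet: "e \<inter> f \<noteq> {}" if "e \<in> edges (whisker H)" "f \<in> edges (whisker H)" "e \<subseteq> F" "f \<subseteq> F" for e f
  proof (cases "e = f")
    case True
    have "card e = 2" using finite_simple_graph_whisker[OF H] that by (auto simp: finite_simple_graph_def)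
    then show ?thesis using True by auto
  next
    case False
    then show ?thesis using F that unfolding matching_free_2_iff by blast
  qed
  show ?thesis
  proof (cases "\<exists>x\<in>verts H. {Inl x, Inr x} \<subseteq> F")
    case True
    then obtain x where x: "x \<in> verts H" "{Inl x, Inr x} \<subseteq> F" by blast
    have "Inl x \<in> e" if e: "e \<in> edges (whisker H)" "e \<subseteq> F" for e
    proof -
      have "{Inl x, Inr x} \<inter> e \<noteq> {}" using meet[OF whisker_edges(2)[OF x(1)] e(1) x(2) e(2)] .
      with e(1) show ?thesis by (cases rule: whisker_edge_cases) auto
    qed
    then show ?thesis using x(1) by blast
  next
    case nowhisk: False
    have base: "\<exists>f\<in>edges H. e = Inl ` f" if "e \<in> edges (whisker H)" "e \<subseteq> F" for e
      using that(1) by (cases rule: whisker_edge_cases) (use that(2) nowhisk in auto)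
    define B where "B = {f \<in> edges H. Inl ` f \<subseteq> F}"
    have meetB: "f \<inter> g \<noteq> {}" if "f \<in> B" "g \<in> B" for f g
      using meet[of "Inl ` f" "Inl ` g"] that whisker_edges(1) unfolding B_def by blast
    have "\<exists>x\<in>verts H. \<forall>f\<in>B. x \<in> f"
    proof (cases "B = {}")
      case True
      then show ?thesis using ne by blast
    next
      case False
      then obtain e where e: "e \<in> B" by blast
      then have "card e = 2" using finite_simple_graphD(3)[OF H] by (simp add: B_def)
      then obtain a b where ab: "e = {a, b}" "a \<noteq> b" by (auto simp: card_2_iff)
      have abV: "a \<in> verts H" "b \<in> verts H" using finite_simple_graphD(2)[OF H, of e] e ab by (auto simp: B_def)
      show ?thesis
      proof (rule ccontr)
        assume no: "\<not> ?thesis"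
        obtain f g where f: "f \<in> B" "a \<notin> f" and g: "g \<in> B" "b \<notin> g" using no abV by blast
        have "b \<in> f" using meetB[OF e f(1)] f(2) ab by blast
        moreover have "card f = 2" using f(1) finite_simple_graphD(3)[OF H] by (simp add: B_def)
        ultimately obtain c where c: "f = {b, c}" "b \<noteq> c" by (auto simp: card_2_iff)
        have "a \<in> g" using meetB[OF e g(1)] g(2) ab by blast
        moreover have "card g = 2" using g(1) finite_simple_graphD(3)[OF H] by (simp add: B_def)
        ultimately obtain c' where c': "g = {a, c'}" "a \<noteq> c'" by (auto simp: card_2_iff)
        have "c = c'" using meetB[OF f(1) g(1)] f(2) g(2) c(1) c'(1) by blast
        then have "{a, b} \<in> edges H" "{b, c} \<in> edges H" "{c, a} \<in> edges H"
          using e f(1) g(1) ab(1) c(1) c'(1) by (auto simp: B_def insert_commute)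
        then show False using tf by blast
      qed
    qed
    then obtain x where "x \<in> verts H" "\<And>f. f \<in> B \<Longrightarrow> x \<in> f" by blast
    then have "Inl x \<in> e" if "e \<in> edges (whisker H)" "e \<subseteq> F" for e
      using base[OF that] that unfolding B_def by blast
    then show ?thesis using \<open>x \<in> verts H\<close> by blast
  qed
qed

lemma matching_free_2_facets:
  assumes H: "finite_simple_graph H" and ne: "verts H \<noteq> {}"
    and tf: "\<not> (\<exists>x y z. {x, y} \<in> edges H \<and> {y, z} \<in> edges H \<and> {z, x} \<in> edges H)"
  shows "matching_free_complex 2 (whisker H) = (\<Union>s\<in>star_facet_labels H. Pow (star_facet H s))"
proof (intro set_eqI iffI)
  fix F assume F: "F \<in> matching_free_complex 2 (whisker H)"
  obtain x where x: "x \<in> verts H" and centre: "\<And>e. e \<in> edges (whisker H) \<Longrightarrow> e \<subseteq> F \<Longrightarrow> Inl x \<in> e"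
    using star_centre[OF H ne tf F] by blast
  have FV: "F \<subseteq> verts H <+> verts H" using F unfolding matching_free_2_iff by simp
  define A where "A = {a. a \<noteq> x \<and> Inl a \<in> F}"
  have "A \<subseteq> verts H - {x}" using FV by (auto simp: A_def)
  moreover have "\<not> e \<subseteq> A" if "e \<in> edges H" for e
  proof
    assume eA: "e \<subseteq> A"
    then have "Inl ` e \<subseteq> F" by (auto simp: A_def)
    then have "x \<in> e" using centre[OF whisker_edges(1)[OF that]] by auto
    then show False using eA by (auto simp: A_def)
  qed
  ultimately have "(x, A) \<in> star_facet_labels H" using x by (simp add: star_facet_labels_def)
  moreover have "F \<subseteq> star_facet H (x, A)"
  proof
    fix v assume v: "v \<in> F"
    show "v \<in> star_facet H (x, A)"
    proof (cases v)
      case (Inl a)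
      then show ?thesis using v by (auto simp: star_facet_def A_def)
    next
      case (Inr a)
      then have a: "a \<in> verts H" using v FV by auto
      have "a \<notin> A"
      proof
        assume "a \<in> A"
        then have "{Inl a, Inr a} \<subseteq> F" "a \<noteq> x" using v Inr by (auto simp: A_def)
        then show False using centre[OF whisker_edges(2)[OF a]] by auto
      qed
      then show ?thesis using a Inr by (simp add: star_facet_def)
    qed
  qed
  ultimately show "F \<in> (\<Union>s\<in>star_facet_labels H. Pow (star_facet H s))" by blast
next
  fix F assume "F \<in> (\<Union>s\<in>star_facet_labels H. Pow (star_facet H s))"
  then obtain x A where xA: "(x, A) \<in> star_facet_labels H" and F: "F \<subseteq> star_facet H (x, A)" by auto
  have x: "x \<in> verts H" "A \<subseteq> verts H - {x}" "\<And>e. e \<in> edges H \<Longrightarrow> \<not> e \<subseteq> A"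
    using xA by (auto simp: star_facet_labels_def)
  have centre: "Inl x \<in> e" if e: "e \<in> edges (whisker H)" "e \<subseteq> star_facet H (x, A)" for e
    using e(1)
  proof (cases rule: whisker_edge_cases)
    case (base f)
    then have "f \<subseteq> insert x A" using e(2) by (auto simp: star_facet_def)
    then have "x \<in> f" using x(3)[OF base(1)] by blast
    then show ?thesis using base by simp
  next
    case (whisk a)
    then show ?thesis using e(2) by (auto simp: star_facet_def)
  qed
  have "star_facet H (x, A) \<subseteq> verts (whisker H)" using x by (auto simp: star_facet_def)
  then have FV: "F \<subseteq> verts (whisker H)" using F by (rule order_trans[rotated])
  show "F \<in> matching_free_complex 2 (whisker H)"
    unfolding matching_free_2_iff
  proof (intro conjI ballI impI FV)
    fix e f assume "e \<in> edges (whisker H)" "f \<in> edges (whisker H)" "e \<subseteq> F" "f \<subseteq> F"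
    then have "Inl x \<in> e" "Inl x \<in> f" using F by (meson centre order_trans)+
    then show "e \<inter> f \<noteq> {}" by blast
  qed
qed

lemma card_star_facet:
  assumes H: "finite_simple_graph H" and s: "s \<in> star_facet_labels H"
  shows "finite (star_facet H s)" "card (star_facet H s) = Suc (card (verts H))"
proof -
  obtain x A where xA: "s = (x, A)" "x \<in> verts H" "A \<subseteq> verts H - {x}"
    using s by (auto simp: star_facet_labels_def)
  have fin: "finite (verts H)" "finite A" using finite_simple_graphD(1)[OF H] xA by (auto intro: finite_subset)
  show "finite (star_facet H s)" using fin xA by (simp add: star_facet_def)
  have "card (star_facet H s) = card (Inl ` insert x A :: ('a + 'a) set) + card (Inr ` (verts H - A) :: ('a + 'a) set)"
    unfolding star_facet_def xA using fin by (subst card_Un_disjoint) auto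
  also have "\<dots> = card (insert x A) + card (verts H - A)"
    by (simp only: card_image inj_Inl inj_Inr)
  also have "card (insert x A) = Suc (card A)"
    using xA(3) by (intro card_insert_disjoint[OF fin(2)]) blast
  also have "card (verts H - A) = card (verts H) - card A" using fin xA by (intro card_Diff_subset) auto
  moreover have "card A \<le> card (verts H)" using fin xA by (intro card_mono) auto
  ultimately show "card (star_facet H s) = Suc (card (verts H))" by simp
qed

text \<open>The key compares the size of \<open>A\<close> first and the position of the centre second. From the facet
\<open>(x, A)\<close> one can remove a base vertex \<open>a \<in> A\<close> (exchanging it for its whisker), the centre \<open>x\<close>
(making a member of \<open>A\<close> the centre, or some earlier centre if \<open>A\<close> is empty), or the whisker at
\<open>x\<close> (exchanging the centre with a member of \<open>A\<close> that comes earlier). An earlier facet that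
contains all vertices which can be removed in the first two ways has the same base vertices, and
then the third way applies.\<close>

lemma star_facets_shelling:
  assumes H: "finite_simple_graph H" and st: "(x, A) \<in> star_facet_labels H" "(y, B) \<in> star_facet_labels H"
    and neq: "(y, B) \<noteq> (x, A)" and idx: "inj_on idx (verts H)" "\<And>v. v \<in> verts H \<Longrightarrow> idx v < n"
    and le: "card B * n + idx y \<le> card A * n + idx x"
  shows "\<exists>v\<in>star_facet H (x, A) - star_facet H (y, B). \<exists>(z, C)\<in>star_facet_labels H.
    card C * n + idx z < card A * n + idx x \<and> star_facet H (x, A) - {v} \<subseteq> star_facet H (z, C)"
proof -
  have x: "x \<in> verts H" "A \<subseteq> verts H" "x \<notin> A" "\<And>e. e \<in> edges H \<Longrightarrow> \<not> e \<subseteq> A"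
    and y: "y \<in> verts H" "B \<subseteq> verts H" "y \<notin> B" "\<And>e. e \<in> edges H \<Longrightarrow> \<not> e \<subseteq> B"
    using st by (auto simp: star_facet_labels_def)
  have fin: "finite A" "finite B" using finite_simple_graphD(1)[OF H] x y by (auto intro: finite_subset)
  have lex: "card C * n + idx z < card D * n + idx w" if "card C < card D" "z \<in> verts H" for C D z w
  proof -
    have "card C * n + idx z < card C * n + n" using idx(2)[OF that(2)] by simp
    also have "\<dots> \<le> card D * n" using mult_le_mono1[of "Suc (card C)" "card D" n] that(1) by simp
    finally show ?thesis by simp
  qed
  have BA: "card B \<le> card A" using lex[of A B x y] le x(1) by (meson not_le)
  have remove: "(c, A - {c}) \<in> star_facet_labels H" "(x, A - {c}) \<in> star_facet_labels H" if "c \<in> A" for c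
    using that x unfolding star_facet_labels_def by auto
  have smaller: "card (A - {c}) * n + idx z < card A * n + idx x" if "c \<in> A" "z \<in> verts H" for c z
    using that fin(1) by (intro lex card_Diff1_less)
  show ?thesis
  proof (cases "A \<subseteq> insert y B")
    case False
    then obtain a where a: "a \<in> A" "a \<notin> insert y B" by blast
    have "Inl a \<in> star_facet H (x, A) - star_facet H (y, B)" using a by (auto simp: star_facet_def)
    moreover have "star_facet H (x, A) - {Inl a} \<subseteq> star_facet H (x, A - {a})"
      using a x by (auto simp: star_facet_def)
    ultimately show ?thesis using remove(2)[OF a(1)] smaller[OF a(1) x(1)] by blast
  next
    case sub: True
    show ?thesis
    proof (cases "x \<in> insert y B")
      case x_out: False
      have v: "Inl x \<in> star_facet H (x, A) - star_facet H (y, B)" using x_out by (auto simp: star_facet_def)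
      show ?thesis
      proof (cases "A = {}")
        case True
        then have "B = {}" using BA fin by simp
        then have "idx y \<le> idx x" using le True by simp
        moreover have "idx y \<noteq> idx x" using inj_onD[OF idx(1)] x y x_out by blast
        ultimately have "card B * n + idx y < card A * n + idx x" using True \<open>B = {}\<close> by simp
        moreover have "star_facet H (x, A) - {Inl x} \<subseteq> star_facet H (y, B)"
          using True \<open>B = {}\<close> by (auto simp: star_facet_def)
        ultimately show ?thesis using v st(2) by blast
      next
        case False
        then obtain a where a: "a \<in> A" by blast
        have "star_facet H (x, A) - {Inl x} \<subseteq> star_facet H (a, A - {a})"
          using a by (auto simp: star_facet_def)
        moreover have "a \<in> verts H" using a x by blast
        ultimately show ?thesis using v remove(1)[OF a] smaller[OF a] by blast
      qed
    next
      case x_in: True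
      have "insert x A = insert y B"
      proof (rule card_seteq)
        show "insert x A \<subseteq> insert y B" using sub x_in by blast
        show "card (insert y B) \<le> card (insert x A)" using BA fin x y by simp
      qed (use fin in simp)
      then have "y \<noteq> x" using neq x(3) y(3) by (metis insert_ident)
      have "y \<in> insert x A" unfolding \<open>insert x A = insert y B\<close> by simp
      then have xB: "x \<in> B" "y \<in> A" using x_in \<open>y \<noteq> x\<close> by simp_all
      have "card (insert x A) = card (insert y B)" using \<open>insert x A = insert y B\<close> by simp
      then have AB: "card A = card B" using fin x y by simp
      have "idx y < idx x" using le AB inj_onD[OF idx(1)] x y \<open>y \<noteq> x\<close> by (metis add_le_cancel_left le_neq_implies_less)
      then have "card B * n + idx y < card A * n + idx x" using AB by simp
      moreover have "Inr x \<in> star_facet H (x, A) - star_facet H (y, B)" using x xB by (auto simp: star_facet_def)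
      moreover have "star_facet H (x, A) - {Inr x} \<subseteq> star_facet H (y, B)"
        using \<open>insert x A = insert y B\<close> by (auto simp: star_facet_def)
      ultimately show ?thesis using st(2) by blast
    qed
  qed
qed

lemma matching_free_2_cm:
  fixes K :: "'k::field itself"
  assumes H: "finite_simple_graph H"
    and tf: "\<not> (\<exists>x y z. {x, y} \<in> edges H \<and> {y, z} \<in> edges H \<and> {z, x} \<in> edges H)"
  shows "cohen_macaulay K (matching_free_complex 2 (whisker H))"
proof (cases "verts H = {}")
  case True
  then have "matching_free_complex 2 (whisker H) = Pow {}"
    using finite_simple_graphD(2,3)[OF H] unfolding matching_free_2_iff set_eq_iff
    by (auto simp: Plus_def elim!: whisker_edge_cases)
  moreover have "cohen_macaulay K (Pow {} :: ('a + 'a) set set)"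
    by (rule cohen_macaulayI[of "{}" _ _ "-1"])
      (use cm_of_dim_simplex[of "{}" K] in \<open>auto intro: simplicialI\<close>)
  ultimately show ?thesis by simp
next
  case False
  let ?\<Delta> = "matching_free_complex 2 (whisker H)" and ?S = "star_facet_labels H" and ?n = "card (verts H)"
  have fin: "finite (verts H)" by (rule finite_simple_graphD(1)[OF H])
  obtain idx where "bij_betw idx (verts H) {0..<?n}" using ex_bij_betw_finite_nat[OF fin] by blast
  then have idx: "inj_on idx (verts H)" "\<And>v. v \<in> verts H \<Longrightarrow> idx v < ?n"
    by (auto simp: bij_betw_def)
  have \<Delta>_eq: "?\<Delta> = (\<Union>s\<in>?S. Pow (star_facet H s))"
    by (rule matching_free_2_facets[OF H False tf])
  have "cm_of_dim K (int ?n) ?\<Delta>"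
    unfolding \<Delta>_eq
  proof (rule cm_of_dim_shelling[where key = "\<lambda>(x, A). card A * ?n + idx x"])
    have "?S \<subseteq> verts H \<times> Pow (verts H)" by (auto simp: star_facet_labels_def)
    then show "finite ?S" by (rule finite_subset) (simp add: fin)
    fix s assume s: "s \<in> ?S"
    then show "finite (star_facet H s)" "int (card (star_facet H s)) = int ?n + 1"
      using card_star_facet[OF H s] by simp_all
    fix t assume t: "t \<in> ?S" "t \<noteq> s"
      "(case t of (x, A) \<Rightarrow> card A * ?n + idx x) \<le> (case s of (x, A) \<Rightarrow> card A * ?n + idx x)"
    obtain x A where s': "s = (x, A)" by (rule prod.exhaust)
    obtain y B where t': "t = (y, B)" by (rule prod.exhaust)
    have "\<exists>v\<in>star_facet H (x, A) - star_facet H (y, B). \<exists>(z, C)\<in>?S.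
        card C * ?n + idx z < card A * ?n + idx x \<and> star_facet H (x, A) - {v} \<subseteq> star_facet H (z, C)"
      using s t unfolding s' t' by (intro star_facets_shelling[OF H _ _ _ idx]) simp_all
    then obtain v z C where "v \<in> star_facet H s - star_facet H t" "(z, C) \<in> ?S"
      "card C * ?n + idx z < card A * ?n + idx x" "star_facet H s - {v} \<subseteq> star_facet H (z, C)"
      unfolding s' t' by blast
    then show "\<exists>v\<in>star_facet H s - star_facet H t. \<exists>u\<in>?S.
        (case u of (x, A) \<Rightarrow> card A * ?n + idx x) < (case s of (x, A) \<Rightarrow> card A * ?n + idx x) \<and>
        star_facet H s - {v} \<subseteq> star_facet H u"
      by (intro bexI[of _ v] bexI[of _ "(z, C)"]) (simp_all add: s')
  qed
  moreover have "int (card F) \<le> int ?n + 1" if F: "F \<in> ?\<Delta>" for F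
  proof -
    obtain s where s: "s \<in> ?S" "F \<subseteq> star_facet H s" using F unfolding \<Delta>_eq by blast
    then have "card F \<le> card (star_facet H s)" by (intro card_mono card_star_facet[OF H])
    then show ?thesis using card_star_facet(2)[OF H s(1)] by simp
  qed
  moreover have "simplicial (verts (whisker H)) ?\<Delta>"
    by (rule simplicial_matching_free) (simp add: fin)
  ultimately show ?thesis using cohen_macaulayI by metis
qed

section \<open>Matchings that miss one pair of vertices\<close>

text \<open>The pairs of vertices missed by matchings of size one less than the number of whiskers. They
form a copy of the whisker graph in which the copy of \<open>H\<close> sits on the whisker vertices.\<close>

definition defect_edges :: "'a graph \<Rightarrow> ('a + 'a) set set" where
  "defect_edges H = (\<lambda>x. {Inl x, Inr x}) ` verts H \<union> (\<lambda>e. Inr ` e) ` edges H"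

lemma card_defect_edge:
  assumes "finite_simple_graph H"
  shows "\<forall>d\<in>defect_edges H. card d = 2"
  using finite_simple_graphD(3)[OF assms] unfolding defect_edges_def by (auto simp: card_image)

lemma card_verts_whisker: "finite (verts H) \<Longrightarrow> card (verts H <+> verts H) = 2 * card (verts H)"
  by (simp add: card_Plus)

lemma card_Union_matching:
  assumes G: "finite_simple_graph G" and M: "is_matching G M"
  shows "card (\<Union>M) = 2 * card M"
proof -
  have e: "e \<subseteq> verts G" "card e = 2" if "e \<in> M" for e
    using that M G unfolding is_matching_def finite_simple_graph_def by blast+
  then have "card (\<Union>M) = sum card M"
    using M G unfolding is_matching_def finite_simple_graph_def
    by (intro card_Union_disjoint) (auto intro: finite_subset)
  also have "\<dots> = sum (\<lambda>_. 2) M" by (intro sum.cong) (use e in simp_all)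
  finally show ?thesis by simp
qed

text \<open>A missed base vertex forces its whisker to be missed. If only whisker vertices are missed, the
base vertex of one of them is matched inside \<open>H\<close> to some \<open>k\<close>, so that the whisker at \<open>k\<close> is
missed too.\<close>

lemma whisker_matching_missing_pair:
  assumes H: "finite_simple_graph H" and n: "2 \<le> card (verts H)"
    and M: "is_matching (whisker H) M" "card M = card (verts H) - 1"
  shows "verts (whisker H) - \<Union>M \<in> defect_edges H"
proof -
  let ?V = "verts H <+> verts H" and ?C = "verts (whisker H) - \<Union>M"
  have ME: "e \<in> edges (whisker H)" if "e \<in> M" for e using that M(1) by (auto simp: is_matching_def)
  have disj: "e = f" if "e \<in> M" "f \<in> M" "v \<in> e" "v \<in> f" for e f v
    using that M(1) unfolding is_matching_def pairwise_def disjnt_def by blast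
  have finV: "finite ?V" using finite_simple_graphD(1)[OF H] by simp
  have UV: "\<Union>M \<subseteq> ?V"
    using ME finite_simple_graph_whisker[OF H] unfolding finite_simple_graph_def by auto
  then have "card ?C = card ?V - card (\<Union>M)"
    using finV by (simp add: card_Diff_subset finite_subset)
  then have cardC: "card ?C = 2"
    using card_Union_matching[OF finite_simple_graph_whisker[OF H] M(1)] M(2) n
      card_verts_whisker[OF finite_simple_graphD(1)[OF H]] by simp
  have finC: "finite ?C" using finV by simp
  show ?thesis
  proof (cases "\<exists>x. Inl x \<in> ?C")
    case True
    then obtain x where x: "Inl x \<in> ?C" by blast
    have "Inr x \<notin> \<Union>M"
    proof
      assume "Inr x \<in> \<Union>M"
      then obtain e where e: "e \<in> M" "Inr x \<in> e" by blast
      from ME[OF e(1)] have "Inl x \<in> e" using e(2) by (cases rule: whisker_edge_cases) auto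
      then show False using x e(1) by blast
    qed
    then have sub: "{Inl x, Inr x} \<subseteq> ?C" using x by auto
    have "{Inl x, Inr x} = ?C" using cardC by (intro card_subset_eq[OF finC sub]) simp
    moreover have "{Inl x, Inr x} \<in> defect_edges H" using x by (auto simp: defect_edges_def)
    ultimately show ?thesis by metis
  next
    case False
    obtain p q where pq: "?C = {p, q}" "p \<noteq> q" using cardC unfolding card_2_iff by blast
    obtain i where i: "p = Inr i" using False pq(1) by (cases p) auto
    obtain j where j: "q = Inr j" using False pq(1) by (cases q) auto
    have iC: "Inr i \<in> ?C" using pq(1) i by blast
    then have "i \<in> verts H" by auto
    then have "Inl i \<in> \<Union>M" using False by auto
    then obtain e where e: "e \<in> M" "Inl i \<in> e" by blast
    have "Inr i \<notin> e" using e(1) iC by blast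
    from ME[OF e(1)] obtain f where f: "f \<in> edges H" "e = Inl ` f"
      using e(2) \<open>Inr i \<notin> e\<close> by (cases rule: whisker_edge_cases) auto
    have "i \<in> f" using e(2) f(2) by auto
    then obtain k where k: "f = {i, k}" "k \<noteq> i"
      using finite_simple_graphD(3)[OF H f(1)] unfolding card_2_iff by blast
    have "Inr k \<notin> \<Union>M"
    proof
      assume "Inr k \<in> \<Union>M"
      then obtain g where g: "g \<in> M" "Inr k \<in> g" by blast
      from ME[OF g(1)] have "Inl k \<in> g" using g(2) by (cases rule: whisker_edge_cases) auto
      then have "g = e" using disj[OF g(1) e(1)] f(2) k(1) by simp
      then show False using g(2) f(2) by auto
    qed
    moreover have "k \<in> verts H" using finite_simple_graphD(2)[OF H f(1)] k(1) by blast
    ultimately have "Inr k \<in> ?C" by (simp add: InrI)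
    then have "k = j" using k(2) unfolding pq(1) i j by simp
    then have "?C = Inr ` f" unfolding pq(1) i j k(1) by simp
    then show ?thesis using f(1) unfolding defect_edges_def by blast
  qed
qed

text \<open>All whisker edges disjoint from \<open>d\<close> are used; if \<open>d\<close> consists of the whisker vertices over an
edge of \<open>H\<close>, that edge itself is added.\<close>

lemma whisker_matching_avoiding_defect:
  assumes H: "finite_simple_graph H" and d: "d \<in> defect_edges H"
  shows "\<exists>M. is_matching (whisker H) M \<and> \<Union>M \<inter> d = {} \<and> card M = card (verts H) - 1"
proof -
  let ?w = "\<lambda>x. {Inl x, Inr x}"
  have inj: "inj_on ?w A" for A :: "'a set" by (auto simp: inj_on_def doubleton_eq_iff)
  have fin: "finite (verts H)" by (rule finite_simple_graphD(1)[OF H])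
  from d consider (whisk) x where "x \<in> verts H" "d = ?w x" | (base) e where "e \<in> edges H" "d = Inr ` e"
    unfolding defect_edges_def by blast
  then show ?thesis
  proof cases
    case whisk
    let ?M = "?w ` (verts H - {x})"
    have "is_matching (whisker H) ?M"
      unfolding is_matching_def by (auto simp: whisker_edges pairwise_def disjnt_def)
    moreover have "\<Union>?M \<inter> d = {}" using whisk by auto
    moreover have "card ?M = card (verts H) - 1"
      using whisk(1) fin by (subst card_image[OF inj]) simp
    ultimately show ?thesis by blast
  next
    case base
    let ?W = "?w ` (verts H - e)"
    have e: "e \<subseteq> verts H" "card e = 2" using finite_simple_graphD(2,3)[OF H base(1)] by blast+
    have "Inl ` e \<noteq> ?w x" for x by auto
    then have new: "Inl ` e \<notin> ?W" by blast
    have "is_matching (whisker H) (insert (Inl ` e) ?W)"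
      unfolding is_matching_def
    proof
      show "insert (Inl ` e) ?W \<subseteq> edges (whisker H)" using base by (auto simp: whisker_edges)
      have "pairwise disjnt ?W" by (auto simp: pairwise_def disjnt_def)
      moreover have "disjnt (Inl ` e) f" "disjnt f (Inl ` e)" if "f \<in> ?W" for f
        using that by (auto simp: disjnt_def)
      ultimately show "pairwise disjnt (insert (Inl ` e) ?W)" by (simp add: pairwise_insert)
    qed
    moreover have "\<Union>(insert (Inl ` e) ?W) \<inter> d = {}" using base by auto
    moreover have "card (insert (Inl ` e) ?W) = card (verts H) - 1"
    proof -
      have "card ?W = card (verts H) - 2"
        using e fin finite_subset[OF e(1) fin] by (subst card_image[OF inj]) (simp add: card_Diff_subset)
      moreover have "2 \<le> card (verts H)" using card_mono[OF fin e(1)] e(2) by simp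
      ultimately show ?thesis using new fin by simp
    qed
    ultimately show ?thesis by blast
  qed
qed

text \<open>A set contains a matching of size \<open>n - 1\<close> if and only if its complement lies in a defect edge.
As every vertex lies on a defect edge, these complements are precisely the faces of the graph of
defect edges.\<close>

lemma matching_free_corank_1_eq_graph_dual:
  assumes H: "finite_simple_graph H" and n: "2 \<le> card (verts H)"
  shows "matching_free_complex (card (verts H) - 1) (whisker H) =
    graph_dual (verts (whisker H)) (defect_edges H)"
proof -
  let ?V = "verts (whisker H)" and ?q = "card (verts H) - 1" and ?D = "defect_edges H"
  have finV: "finite ?V" using finite_simple_graphD(1)[OF H] by simp
  have matching: "(\<exists>M. is_matching (induced_subgraph (whisker H) F) M \<and> card M = ?q) \<longleftrightarrow>
      (\<exists>d\<in>?D. ?V - F \<subseteq> d)" if F: "F \<subseteq> ?V" for F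
  proof
    assume "\<exists>M. is_matching (induced_subgraph (whisker H) F) M \<and> card M = ?q"
    then obtain M where M: "is_matching (induced_subgraph (whisker H) F) M" "card M = ?q" by blast
    then have "is_matching (whisker H) M" "\<Union>M \<subseteq> F"
      unfolding is_matching_def induced_subgraph_def by auto
    moreover from this(2) have "?V - F \<subseteq> ?V - \<Union>M" by blast
    ultimately show "\<exists>d\<in>?D. ?V - F \<subseteq> d" using whisker_matching_missing_pair[OF H n _ M(2)] by blast
  next
    assume "\<exists>d\<in>?D. ?V - F \<subseteq> d"
    then obtain d where d: "d \<in> ?D" "?V - F \<subseteq> d" by blast
    obtain M where M: "is_matching (whisker H) M" "\<Union>M \<inter> d = {}" "card M = ?q"
      using whisker_matching_avoiding_defect[OF H d(1)] by blast
    have "e \<subseteq> F" if "e \<in> M" for e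
    proof -
      have "e \<subseteq> ?V"
        using that M(1) finite_simple_graph_whisker[OF H]
        unfolding is_matching_def finite_simple_graph_def by blast
      moreover have "e \<inter> d = {}" using M(2) that by blast
      ultimately show ?thesis using d(2) by blast
    qed
    then have "is_matching (induced_subgraph (whisker H) F) M"
      using M(1) unfolding is_matching_def induced_subgraph_def by auto
    then show "\<exists>M. is_matching (induced_subgraph (whisker H) F) M \<and> card M = ?q" using M(3) by blast
  qed
  have small: "(\<exists>d\<in>?D. C \<subseteq> d) \<longleftrightarrow> card C < 2 \<or> C \<in> ?D" if C: "C \<subseteq> ?V" for C
  proof
    assume "\<exists>d\<in>?D. C \<subseteq> d"
    then obtain d where d: "d \<in> ?D" "C \<subseteq> d" by blast
    then have "card d = 2" using card_defect_edge[OF H] by blast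
    moreover from this have "finite d" by (intro card_ge_0_finite) simp
    ultimately have "C = d" if "2 \<le> card C" using card_seteq[of d C] d(2) that by simp
    then show "card C < 2 \<or> C \<in> ?D" using d(1) by (cases "2 \<le> card C") simp_all
  next
    assume "card C < 2 \<or> C \<in> ?D"
    then show "\<exists>d\<in>?D. C \<subseteq> d"
    proof
      assume "card C < 2"
      have w: "{Inl x, Inr x} \<in> ?D" if "x \<in> verts H" for x using that by (simp add: defect_edges_def)
      have "finite C" using C finV by (rule finite_subset)
      then have "C = {} \<or> card C = 1" using \<open>card C < 2\<close> by (cases "card C") auto
      then show ?thesis
      proof
        assume "C = {}"
        moreover obtain x where "x \<in> verts H" using n by fastforce
        ultimately show ?thesis using w by blast
      next
        assume "card C = 1"
        then obtain v where v: "C = {v}" by (rule card_1_singletonE)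
        then obtain x where "x \<in> verts H" "v \<in> {Inl x, Inr x}" using C by (cases v) auto
        then show ?thesis using w v by blast
      qed
    qed blast
  qed
  have "F \<in> matching_free_complex ?q (whisker H) \<longleftrightarrow> F \<in> graph_dual ?V ?D" for F
  proof (cases "F \<subseteq> ?V")
    case True
    then show ?thesis
      unfolding matching_free_complex_def graph_dual_def mem_Collect_eq matching[OF True]
      by (simp only: small[OF Diff_subset] de_Morgan_disj not_less)
  qed (simp add: matching_free_complex_def graph_dual_def)
  then show ?thesis by blast
qed

text \<open>The first vertex of a longest path has two neighbours, both on the path by maximality; the one
that is not its successor closes a cycle.\<close>

lemma min_degree_2_imp_cycle:
  assumes H: "finite_simple_graph H" and W: "W \<subseteq> verts H" "W \<noteq> {}"
    and deg: "\<And>v. v \<in> W \<Longrightarrow> 2 \<le> card {w \<in> W. {v, w} \<in> edges H}"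
  shows "\<exists>c. is_cycle H c"
proof -
  define path where "path p \<longleftrightarrow> p \<noteq> [] \<and> distinct p \<and> set p \<subseteq> W \<and>
    (\<forall>i. Suc i < length p \<longrightarrow> {p ! i, p ! Suc i} \<in> edges H)" for p
  have finW: "finite W" using finite_simple_graphD(1)[OF H] W(1) by (rule finite_subset[rotated])
  have bound: "length p \<le> card W" if "path p" for p
    using that card_mono[OF finW, of "set p"] by (simp add: path_def distinct_card)
  obtain v where "v \<in> W" using W(2) by blast
  then have "path [v]" by (simp add: path_def)
  then obtain p where p: "path p" and max: "\<And>r. path r \<Longrightarrow> length r \<le> length p"
    using ex_has_greatest_nat[of path "[v]" length "Suc (card W)"] bound by (metis le_imp_less_Suc)
  have pp: "p \<noteq> []" "distinct p" "set p \<subseteq> W"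
    "\<And>i. Suc i < length p \<Longrightarrow> {p ! i, p ! Suc i} \<in> edges H"
    using p by (auto simp: path_def)
  define h where "h = p ! 0"
  define N where "N = {w \<in> W. {h, w} \<in> edges H}"
  have hW: "h \<in> W" using pp(1,3) by (auto simp: h_def)
  have "\<not> N \<subseteq> {p ! 1}"
  proof
    assume "N \<subseteq> {p ! 1}"
    then have "card N \<le> card {p ! 1}" by (intro card_mono) simp_all
    then show False using deg[OF hW] by (simp add: N_def)
  qed
  then obtain w where w: "w \<in> W" "{h, w} \<in> edges H" "w \<noteq> p ! 1" by (auto simp: N_def)
  have "w \<in> set p"
  proof (rule ccontr)
    assume "w \<notin> set p"
    have "path (w # p)"
      unfolding path_def
    proof (intro conjI allI impI)
      show "{(w # p) ! i, (w # p) ! Suc i} \<in> edges H" if "Suc i < length (w # p)" for i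
      proof (cases i)
        case 0
        then show ?thesis using w(2) by (simp add: h_def insert_commute)
      next
        case (Suc j)
        then show ?thesis using pp(4)[of j] that by simp
      qed
    qed (use pp w \<open>w \<notin> set p\<close> in auto)
    then show False using max by fastforce
  qed
  then obtain k where k: "k < length p" "w = p ! k" by (metis in_set_conv_nth)
  have "w \<noteq> h" using finite_simple_graphD(4)[OF H w(2)] by blast
  then have "k \<noteq> 0" unfolding k(2) h_def by metis
  moreover have "k \<noteq> 1" using w(3) unfolding k(2) by metis
  ultimately have k2: "2 \<le> k" by simp
  define c where "c = take (Suc k) p"
  have len: "length c = Suc k" using k(1) by (simp add: c_def)
  have "is_cycle H c"
    unfolding is_cycle_def
  proof (intro conjI)
    show "3 \<le> length c" using len k2 by simp
    show "distinct c" using pp(2) by (simp add: c_def)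
    have "set c \<subseteq> set p" unfolding c_def by (rule set_take_subset)
    then show "set c \<subseteq> verts H" using pp(3) W(1) by blast
    show "cycle_edges c \<subseteq> edges H"
    proof
      fix e assume "e \<in> cycle_edges c"
      then obtain i where i: "i < Suc k" "e = {c ! i, c ! (Suc i mod Suc k)}"
        unfolding cycle_edges_def len by blast
      show "e \<in> edges H"
      proof (cases "i = k")
        case True
        then have "e = {p ! k, p ! 0}" using i(2) by (simp add: c_def)
        then show ?thesis using w(2) k(2) by (simp add: h_def insert_commute)
      next
        case False
        then have "e = {p ! i, p ! Suc i}" using i by (simp add: c_def)
        then show ?thesis using pp(4)[of i] i(1) False k(1) by simp
      qed
    qed
  qed
  then show ?thesis by blast
qed

text \<open>Base vertices have degree one in the graph of defect edges, and on the whisker vertices this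
graph is a copy of \<open>H\<close>.\<close>

lemma acyclic_defect_edges_degenerate:
  assumes H: "finite_simple_graph H" and acyclic: "\<not> (\<exists>c. is_cycle H c)"
    and W: "W \<subseteq> verts (whisker H)" "W \<noteq> {}"
  shows "\<exists>v\<in>W. card {w \<in> W. {v, w} \<in> defect_edges H} \<le> 1"
proof (cases "\<exists>x. Inl x \<in> W")
  case True
  then obtain x where x: "Inl x \<in> W" by blast
  have "{w \<in> W. {Inl x, w} \<in> defect_edges H} \<subseteq> {Inr x}"
    unfolding defect_edges_def by (auto simp: doubleton_eq_iff)
  then have "card {w \<in> W. {Inl x, w} \<in> defect_edges H} \<le> card {Inr x :: 'a + 'a}"
    by (intro card_mono) simp_all
  then show ?thesis using x by (intro bexI[of _ "Inl x"]) simp_all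
next
  case False
  define U where "U = {x. Inr x \<in> W}"
  have WU: "W = Inr ` U"
  proof (intro set_eqI iffI)
    fix v assume "v \<in> W"
    then show "v \<in> Inr ` U" using False by (cases v) (auto simp: U_def)
  qed (auto simp: U_def)
  have U: "U \<subseteq> verts H" "U \<noteq> {}" using W unfolding WU by auto
  obtain v where v: "v \<in> U" "\<not> 2 \<le> card {w \<in> U. {v, w} \<in> edges H}"
    using min_degree_2_imp_cycle[OF H U] acyclic by blast
  have "{v, w} \<in> edges H" if vw: "{Inr v, Inr w} \<in> defect_edges H" for w
  proof -
    have "{Inr v, Inr w} \<notin> (\<lambda>x. {Inl x, Inr x}) ` verts H" by (auto simp: doubleton_eq_iff)
    then have "{Inr v, Inr w} \<in> ((`) Inr ` edges H :: ('a + 'a) set set)"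
      using vw by (simp add: defect_edges_def)
    then obtain e where e: "e \<in> edges H" "{Inr v, Inr w} = (Inr ` e :: ('a + 'a) set)" by (rule imageE)
    have "Inr ` {v, w} = (Inr ` e :: ('a + 'a) set)" using e(2) by simp
    then have "{v, w} = e" by (simp only: inj_image_eq_iff[OF inj_Inr])
    then show ?thesis using e(1) by simp
  qed
  then have sub: "{w \<in> W. {Inr v, w} \<in> defect_edges H} \<subseteq> Inr ` {w \<in> U. {v, w} \<in> edges H}"
    unfolding WU by blast
  have "finite U" using U(1) finite_simple_graphD(1)[OF H] by (rule finite_subset)
  then have "finite {w \<in> U. {v, w} \<in> edges H}" by simp
  then have "card {w \<in> W. {Inr v, w} \<in> defect_edges H} \<le> card {w \<in> U. {v, w} \<in> edges H}"
    using card_mono[OF _ sub] card_image_le[of "{w \<in> U. {v, w} \<in> edges H}" "Inr :: 'a \<Rightarrow> 'a + 'a"] by simp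
  then have "card {w \<in> W. {Inr v, w} \<in> defect_edges H} \<le> 1" using v(2) by linarith
  moreover have "Inr v \<in> W" using v(1) by (simp add: WU)
  ultimately show ?thesis by blast
qed

lemma cycle_in_defect_edges:
  assumes "is_cycle H c"
  shows "is_cycle (verts (whisker H), defect_edges H) (map Inr c)"
proof -
  have c: "3 \<le> length c" "distinct c" "set c \<subseteq> verts H" "cycle_edges c \<subseteq> edges H"
    using assms by (auto simp: is_cycle_def)
  have "cycle_edges (map Inr c :: ('a + 'a) list) \<subseteq> defect_edges H"
  proof
    fix e assume "e \<in> cycle_edges (map Inr c :: ('a + 'a) list)"
    then obtain i where i: "i < length c" "e = {map Inr c ! i, map Inr c ! (Suc i mod length c)}"
      unfolding cycle_edges_def by auto
    have "Suc i mod length c < length c" by (rule mod_less_divisor) (use i(1) in linarith)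
    then have "e = Inr ` {c ! i, c ! (Suc i mod length c)}" using i by simp
    moreover have "{c ! i, c ! (Suc i mod length c)} \<in> edges H"
      using c(4) i(1) unfolding cycle_edges_def by blast
    ultimately show "e \<in> defect_edges H" unfolding defect_edges_def by blast
  qed
  then show ?thesis using c unfolding is_cycle_def by (auto simp: distinct_map)
qed

text \<open>The complex has \<open>2 n\<close> vertices and dimension \<open>2 n - 3\<close>: two base vertices never form a defect
edge, so their complement is a face. Hence the homology class of a cycle, in degree \<open>2 n - 4\<close>,
is an obstruction.\<close>

lemma corank_1_cm_iff_acyclic:
  fixes K :: "'k::field itself"
  assumes H: "finite_simple_graph H" and n: "2 \<le> card (verts H)"
  shows "cohen_macaulay K (matching_free_complex (card (verts H) - 1) (whisker H)) \<longleftrightarrow>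
    \<not> (\<exists>c. is_cycle H c)"
proof -
  let ?V = "verts (whisker H)" and ?D = "defect_edges H"
  let ?\<Delta> = "graph_dual ?V ?D"
  have finV: "finite ?V" using finite_simple_graphD(1)[OF H] by simp
  have cardV: "card ?V = 2 * card (verts H)" using card_verts_whisker[OF finite_simple_graphD(1)[OF H]] by simp
  have \<Delta>: "simplicial ?V ?\<Delta>" by (rule simplicial_graph_dual[OF finV card_defect_edge[OF H]])
  have "cohen_macaulay K ?\<Delta>" if "\<not> (\<exists>c. is_cycle H c)"
  proof (rule cohen_macaulayI[OF \<Delta>])
    show "cm_of_dim K (int (card ?V) - 3) ?\<Delta>"
      by (rule cm_graph_dual_forest[OF finV card_defect_edge[OF H]])
        (rule acyclic_defect_edges_degenerate[OF H that])
    show "int (card F) \<le> int (card ?V) - 3 + 1" if F: "F \<in> ?\<Delta>" for F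
    proof -
      have "F \<subseteq> ?V" "2 \<le> card (?V - F)" using F by (auto simp: graph_dual_def)
      moreover have "card (?V - F) = card ?V - card F" "card F \<le> card ?V"
        using card_Diff_subset[OF finite_subset[OF \<open>F \<subseteq> ?V\<close> finV] \<open>F \<subseteq> ?V\<close>]
          card_mono[OF finV \<open>F \<subseteq> ?V\<close>] by blast+
      ultimately show ?thesis by linarith
    qed
  qed
  moreover have "\<not> cohen_macaulay K ?\<Delta>" if "is_cycle H c" for c
  proof
    assume cm: "cohen_macaulay K ?\<Delta>"
    have "\<not> card (verts H) \<le> Suc 0" using n by simp
    then obtain x y where xy: "x \<in> verts H" "y \<in> verts H" "x \<noteq> y"
      unfolding card_le_Suc0_iff_eq[OF finite_simple_graphD(1)[OF H]] by blast
    let ?p = "{Inl x, Inl y} :: ('a + 'a) set"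
    have "?p \<notin> ?D"
    proof
      assume "?p \<in> ?D"
      then consider z where "?p = {Inl z, Inr z}" | e where "?p = Inr ` e"
        unfolding defect_edges_def by blast
      then show False
      proof cases
        case 1
        then show False by (simp add: doubleton_eq_iff)
      next
        case (2 e)
        have "Inl x \<in> ?p" by simp
        then show False unfolding 2 by auto
      qed
    qed
    moreover have p: "?p \<subseteq> ?V" "card ?p = 2" using xy by auto
    moreover have "?V - (?V - ?p) = ?p" using p(1) by blast
    ultimately have F: "?V - ?p \<in> ?\<Delta>" by (simp only: graph_dual_def mem_Collect_eq) simp
    have cardF: "int (card (?V - ?p)) = int (card ?V) - 2"
      using p finV cardV n by (simp add: card_Diff_subset)
    have "{} \<in> ?\<Delta>" using simplicialD(3)[OF \<Delta> F] by blast
    moreover have "?V - ?p \<in> link ?\<Delta> {}" using F unfolding link_empty_face .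
    moreover have "int (card ?V) - 4 < int (card (?V - ?p)) - 1" using cardF by linarith
    ultimately have "reduced_homology_vanishes K (link ?\<Delta> {}) (int (card ?V) - 4)"
      by (rule cohen_macaulayD[OF cm \<Delta>])
    then show False
      using graph_dual_cycle_homology[OF finV card_defect_edge[OF H] cycle_in_defect_edges[OF that], where K = K]
      unfolding link_empty_face by blast
  qed
  ultimately show ?thesis unfolding matching_free_corank_1_eq_graph_dual[OF H n] by blast
qed

section \<open>The characterization\<close>

theorem theorem1p3:
  fixes H :: "'a graph" and G :: "('a + 'a) graph"
    and n :: nat and m :: enat and K :: "'k::field itself"
  assumes "finite_simple_graph H"
    and "card (verts H) = n"
    and "m = girth H"
    and "G = whisker H"
  shows "(cohen_macaulay K (matching_free_complex 2 G) \<longleftrightarrow>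
            \<not> (\<exists>c. is_induced_cycle H c \<and> length c = 3)) \<and>
         (n \<ge> 2 \<longrightarrow>
            (m = \<infinity> \<longleftrightarrow> cohen_macaulay K (matching_free_complex (n - 1) G)))"
proof -
  have "cohen_macaulay K (matching_free_complex 2 G) \<longleftrightarrow>
      \<not> (\<exists>c. is_induced_cycle H c \<and> length c = 3)"
    unfolding induced_triangle_iff[OF assms(1)] assms(4)
    using matching_free_2_not_cm[OF assms(1)] matching_free_2_cm[OF assms(1)] by blast
  moreover have "m = \<infinity> \<longleftrightarrow> cohen_macaulay K (matching_free_complex (n - 1) G)" if "n \<ge> 2"
    using corank_1_cm_iff_acyclic[OF assms(1), of K] that girth_infinite_iff[of H] assms(2-4) by simp
  ultimately show ?thesis by blast
qed

end
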